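(* Let $\Phi$ be an irreducible block tridiagonal quantum Markov chain on $V=\mathbb{Z}_{\ge 0}$ with internal space $\mathbb{C}^N$ and matrix representation $$\Phi=\begin{bmatrix} B_0 & C_1 & & \\ A_0 & B_1 & C_2 & \\ & A_1 & B_2 & C_3 \\ & & \ddots & \ddots & \ddots\end{bmatrix},\qquad A_n,B_n,C_{n+1}\in M_{N^2}(\mathbb{C}),\ n\ge 0,$$ and suppose that $\Phi$ admits a weight matrix $W$. Then $\Phi$ is positive recurrent if and only if $W$ has a finite jump at $x=1$, i.e. $W(\{1\})\neq 0$.
   Context: A quantum Markov chain (QMC) on a vertex set $V$ with internal space $\mathbb{C}^N$ is a block matrix $\Phi=(\Phi_{ij})_{i,j\in V}$ of completely positive maps $\Phi_{ij}$ on $M_N(\mathbb{C})$ such that each column sum $\sum_{i\in V}\Phi_{ij}$ is trace-preserving. It acts on columns $(\rho_j)_{j\in V}$ by $\Phi(\rho)_i=\sum_j\Phi_{ij}(\rho_j)$; equivalently it is the completely positive trace-preserving map on trace-class operators of $\mathbb{C}^N\otimes\ell^2(V)$ sending an operator with diagonal blocks $\rho_j$ to $\sum_i\big(\sum_j\Phi_{ij}(\rho_j)\big)\otimes|i\rangle\langle i|$. The matrix representation replaces each $\Phi_{ij}$ by the $N^2\times N^2$ matrix $M$ with $\mathrm{vec}(\Phi_{ij}(X))=M\,\mathrm{vec}(X)$, where $\mathrm{vec}$ stacks the rows of a matrix; $A_n,B_n,C_n$ are the blocks in positions $(n+1,n)$, $(n,n)$, $(n-1,n)$. A positive map $T$ on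 the trace-class operators $\mathcal{I}(\mathcal{K})$ of a Hilbert space $\mathcal{K}$ is irreducible if the only orthogonal projections $P$ with $T(P\mathcal{I}(\mathcal{K})P)\subset P\mathcal{I}(\mathcal{K})P$ are $P=0$ and $P=I$. A QMC is positive recurrent if it is irreducible and admits an invariant distribution, i.e. a column $(\rho_j)_{j\in V}$ with $\rho_j\ge 0$, $\sum_j\mathrm{Tr}(\rho_j)=1$ and $\Phi(\rho)=\rho$. The matrix-valued polynomials associated with $\Phi$ are given by $Q_0(x)=I$, $Q_{-1}(x)=0$, $xQ_n(x)=Q_{n+1}(x)A_n+Q_n(x)B_n+Q_{n-1}(x)C_n$, $n\ge0$ (the $A_n$ being nonsingular). A weight matrix is an $N^2\times N^2$ matrix of measures on $\mathbb{R}$ with finite moments which is positive semidefinite (its value on every Borel set is positive semidefinite). "$\Phi$ admits a weight matrix $W$" means that for all $i,j,n\ge 0$ the $(i,j)$ block of $\Phi^n$ equals $\big(\int_{\mathbb{R}}Q_i^*\,dW\,Q_i\big)^{-1}\int_{\mathbb{R}}x^nQ_i^*(x)\,dW(x)\,Q_j(x)$. *)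

theory Defs
  imports "HOL-Analysis.Analysis"
begin

section \<open>Complex matrices and completely positive maps\<close>

type_synonym 'm cmat = "complex^'m^'m"

definition mstar :: "complex^'a^'b \<Rightarrow> complex^'b^'a" where
  "mstar A = (\<chi> i j. cnj (A $ j $ i))"

(* Over the complex field, a quadratic form that is real and nonnegative forces the matrix to be
   Hermitian. *)
definition psd :: "'m::finite cmat \<Rightarrow> bool" where
  "psd A \<longleftrightarrow> (\<forall>v :: complex^'m. (\<Sum>i\<in>UNIV. \<Sum>j\<in>UNIV. cnj (v $ i) * A $ i $ j * v $ j) \<in> \<real>\<^sub>\<ge>\<^sub>0)"

(* Positive semidefiniteness of the k x k block matrix with blocks X a b, for a, b < k. *)
definition psd_block :: "nat \<Rightarrow> (nat \<Rightarrow> nat \<Rightarrow> 'n::finite cmat) \<Rightarrow> bool" where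
  "psd_block k X \<longleftrightarrow> (\<forall>v :: nat \<Rightarrow> complex^'n.
     (\<Sum>a<k. \<Sum>b<k. \<Sum>i\<in>UNIV. \<Sum>j\<in>UNIV. cnj (v a $ i) * X a b $ i $ j * v b $ j) \<in> \<real>\<^sub>\<ge>\<^sub>0)"

definition clinear_map :: "('n::finite cmat \<Rightarrow> 'n cmat) \<Rightarrow> bool" where
  "clinear_map T \<longleftrightarrow> (\<forall>X Y. T (X + Y) = T X + T Y) \<and>
     (\<forall>c X. T (\<chi> i j. c * X $ i $ j) = (\<chi> i j. c * T X $ i $ j))"

definition completely_positive :: "('n::finite cmat \<Rightarrow> 'n cmat) \<Rightarrow> bool" where
  "completely_positive T \<longleftrightarrow> clinear_map T \<and>
     (\<forall>k X. psd_block k X \<longrightarrow> psd_block k (\<lambda>a b. T (X a b)))"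


section \<open>Row-stacking and matrix representations\<close>

(* Vectors of length N^2 are indexed by pairs (row, column). *)
definition rvec :: "'n::finite cmat \<Rightarrow> complex^('n \<times> 'n)" where
  "rvec X = (\<chi> p. X $ fst p $ snd p)"

definition unrvec :: "complex^('n \<times> 'n) \<Rightarrow> 'n::finite cmat" where
  "unrvec v = (\<chi> i j. v $ (i, j))"

definition matrix_rep :: "('n::finite cmat \<Rightarrow> 'n cmat) \<Rightarrow> ('n \<times> 'n) cmat" where
  "matrix_rep T = matrix (\<lambda>v. rvec (T (unrvec v)))"

lemma rvec_unrvec [simp]: "rvec (unrvec v) = v" "unrvec (rvec X) = X"
  by (simp_all add: rvec_def unrvec_def vec_eq_iff)

lemma rvec_matrix_rep:
  assumes "clinear_map T"
  shows "rvec (T X) = matrix_rep T *v rvec X"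
proof -
  have "Vector_Spaces.linear (*s) (*s) (\<lambda>v. rvec (T (unrvec v)))"
  proof (rule Vector_Spaces.linear_iff[THEN iffD2], intro conjI allI)
    fix x y :: "complex^('a \<times> 'a)"
    have "unrvec (x + y) = unrvec x + unrvec y" by (simp add: unrvec_def vec_eq_iff)
    then have "T (unrvec (x + y)) = T (unrvec x) + T (unrvec y)"
      using assms by (simp add: clinear_map_def)
    then show "rvec (T (unrvec (x + y))) = rvec (T (unrvec x)) + rvec (T (unrvec y))"
      by (simp add: rvec_def vec_eq_iff)
  next
    fix c and x :: "complex^('a \<times> 'a)"
    have "unrvec (c *s x) = (\<chi> i j. c * unrvec x $ i $ j)" by (simp add: unrvec_def vec_eq_iff)
    then have "T (unrvec (c *s x)) = (\<chi> i j. c * T (unrvec x) $ i $ j)"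
      using assms by (simp add: clinear_map_def)
    then show "rvec (T (unrvec (c *s x))) = c *s rvec (T (unrvec x))"
      by (simp add: rvec_def vec_eq_iff)
  qed (unfold_locales)
  from matrix_works[OF this, of "rvec X"] show ?thesis
    by (simp add: matrix_rep_def)
qed


section \<open>Infinite block matrices\<close>

type_synonym 'm blocks = "nat \<Rightarrow> nat \<Rightarrow> 'm cmat"

definition bone :: "'m::finite blocks" where
  "bone = (\<lambda>i j. if i = j then mat 1 else 0)"

definition bmult :: "'m::finite blocks \<Rightarrow> 'm blocks \<Rightarrow> 'm blocks" where
  "bmult X Y = (\<lambda>i j. \<Sum>k. X i k ** Y k j)"

primrec bpow :: "'m::finite blocks \<Rightarrow> nat \<Rightarrow> 'm blocks" where
  "bpow X 0 = bone"
| "bpow X (Suc n) = bmult X (bpow X n)"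

definition badj :: "'m::finite blocks \<Rightarrow> 'm blocks" where
  "badj X = (\<lambda>i j. mstar (X j i))"


section \<open>Operators on the Hilbert space K, the tensor product of C^N and l2(V)\<close>

(* A vector of K is a square-summable sequence of vectors of C^N. A bounded operator on K is
   identified with its block matrix (X i j), which determines it. Products, adjoints and
   equality of operators are then bmult, badj and equality of block matrices. *)

definition ell2 :: "(nat \<Rightarrow> complex^'n::finite) set" where
  "ell2 = {u. summable (\<lambda>k. (norm (u k))\<^sup>2)}"

definition ell2_norm :: "(nat \<Rightarrow> complex^'n::finite) \<Rightarrow> real" where
  "ell2_norm u = sqrt (\<Sum>k. (norm (u k))\<^sup>2)"

definition ell2_inner :: "(nat \<Rightarrow> complex^'n::finite) \<Rightarrow> (nat \<Rightarrow> complex^'n) \<Rightarrow> complex" where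
  "ell2_inner u v = (\<Sum>k. \<Sum>i\<in>UNIV. cnj (u k $ i) * v k $ i)"

definition op_apply :: "'n::finite blocks \<Rightarrow> (nat \<Rightarrow> complex^'n) \<Rightarrow> (nat \<Rightarrow> complex^'n)" where
  "op_apply X u = (\<lambda>i. \<Sum>j. X i j *v u j)"

definition bounded_op :: "'n::finite blocks \<Rightarrow> bool" where
  "bounded_op X \<longleftrightarrow> (\<exists>C. \<forall>u\<in>ell2. (\<forall>i. summable (\<lambda>j. X i j *v u j)) \<and>
     op_apply X u \<in> ell2 \<and> ell2_norm (op_apply X u) \<le> C * ell2_norm u)"

definition positive_op :: "'n::finite blocks \<Rightarrow> bool" where
  "positive_op X \<longleftrightarrow> bounded_op X \<and> (\<forall>u\<in>ell2. ell2_inner u (op_apply X u) \<in> \<real>\<^sub>\<ge>\<^sub>0)"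

(* The operator R below is |X|, the positive square root of X* X; the last conjunct says that
   its trace is finite. *)
definition trace_class :: "'n::finite blocks set" where
  "trace_class = {X. bounded_op X \<and>
     (\<exists>R. positive_op R \<and> bmult R R = bmult (badj X) X \<and> summable (\<lambda>k. trace (R k k)))}"

definition orth_projection :: "'n::finite blocks \<Rightarrow> bool" where
  "orth_projection P \<longleftrightarrow> bounded_op P \<and> badj P = P \<and> bmult P P = P"

definition irreducible_map :: "('n::finite blocks \<Rightarrow> 'n blocks) \<Rightarrow> bool" where
  "irreducible_map T \<longleftrightarrow> (\<forall>P. orth_projection P \<longrightarrow>
     T ` ((\<lambda>X. bmult (bmult P X) P) ` trace_class) \<subseteq> (\<lambda>X. bmult (bmult P X) P) ` trace_class \<longrightarrow>
     P = (\<lambda>i j. 0) \<or> P = bone)"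


section \<open>Quantum Markov chains on the nonnegative integers\<close>

type_synonym 'n qmc = "nat \<Rightarrow> nat \<Rightarrow> 'n cmat \<Rightarrow> 'n cmat"

definition is_qmc :: "'n::finite qmc \<Rightarrow> bool" where
  "is_qmc \<Phi> \<longleftrightarrow> (\<forall>i j. completely_positive (\<Phi> i j)) \<and>
     (\<forall>j X. summable (\<lambda>i. \<Phi> i j X) \<and> trace (\<Sum>i. \<Phi> i j X) = trace X)"

definition qmc_apply :: "'n::finite qmc \<Rightarrow> (nat \<Rightarrow> 'n cmat) \<Rightarrow> (nat \<Rightarrow> 'n cmat)" where
  "qmc_apply \<Phi> \<rho> = (\<lambda>i. \<Sum>j. \<Phi> i j (\<rho> j))"

definition qmc_map :: "'n::finite qmc \<Rightarrow> 'n blocks \<Rightarrow> 'n blocks" where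
  "qmc_map \<Phi> X = (\<lambda>i j. if i = j then qmc_apply \<Phi> (\<lambda>k. X k k) i else 0)"

definition qmc_irreducible :: "'n::finite qmc \<Rightarrow> bool" where
  "qmc_irreducible \<Phi> \<longleftrightarrow> irreducible_map (qmc_map \<Phi>)"

definition invariant_distribution :: "'n::finite qmc \<Rightarrow> (nat \<Rightarrow> 'n cmat) \<Rightarrow> bool" where
  "invariant_distribution \<Phi> \<rho> \<longleftrightarrow>
     (\<forall>j. psd (\<rho> j)) \<and> (\<lambda>j. trace (\<rho> j)) sums 1 \<and> qmc_apply \<Phi> \<rho> = \<rho>"

definition positive_recurrent :: "'n::finite qmc \<Rightarrow> bool" where
  "positive_recurrent \<Phi> \<longleftrightarrow> qmc_irreducible \<Phi> \<and> (\<exists>\<rho>. invariant_distribution \<Phi> \<rho>)"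

definition block_tridiagonal :: "'n::finite qmc \<Rightarrow> bool" where
  "block_tridiagonal \<Phi> \<longleftrightarrow> (\<forall>i j. i > Suc j \<or> j > Suc i \<longrightarrow> \<Phi> i j = (\<lambda>X. 0))"

definition qmc_rep :: "'n::finite qmc \<Rightarrow> ('n \<times> 'n) blocks" where
  "qmc_rep \<Phi> = (\<lambda>i j. matrix_rep (\<Phi> i j))"

definition blkA :: "'n::finite qmc \<Rightarrow> nat \<Rightarrow> ('n \<times> 'n) cmat" where
  "blkA \<Phi> n = qmc_rep \<Phi> (Suc n) n"

definition blkB :: "'n::finite qmc \<Rightarrow> nat \<Rightarrow> ('n \<times> 'n) cmat" where
  "blkB \<Phi> n = qmc_rep \<Phi> n n"

(* Only used for n > 0. *)
definition blkC :: "'n::finite qmc \<Rightarrow> nat \<Rightarrow> ('n \<times> 'n) cmat" where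
  "blkC \<Phi> n = qmc_rep \<Phi> (n - 1) n"


section \<open>The associated matrix-valued polynomials\<close>

fun qpoly :: "'n::finite qmc \<Rightarrow> nat \<Rightarrow> real \<Rightarrow> ('n \<times> 'n) cmat" where
  "qpoly \<Phi> 0 x = mat 1"
| "qpoly \<Phi> (Suc 0) x = (x *\<^sub>R mat 1 - blkB \<Phi> 0) ** matrix_inv (blkA \<Phi> 0)"
| "qpoly \<Phi> (Suc (Suc n)) x =
     (x *\<^sub>R qpoly \<Phi> (Suc n) x - qpoly \<Phi> (Suc n) x ** blkB \<Phi> (Suc n) - qpoly \<Phi> n x ** blkC \<Phi> (Suc n))
       ** matrix_inv (blkA \<Phi> (Suc n))"

lemma qpoly_recurrence:
  assumes "invertible (blkA \<Phi> n)"
  shows "x *\<^sub>R qpoly \<Phi> n x = qpoly \<Phi> (Suc n) x ** blkA \<Phi> n + qpoly \<Phi> n x ** blkB \<Phi> n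
           + (if n = 0 then 0 else qpoly \<Phi> (n - 1) x ** blkC \<Phi> n)"
proof -
  have inv: "matrix_inv (blkA \<Phi> n) ** blkA \<Phi> n = mat 1"
    using assms unfolding invertible_def matrix_inv_def by (rule someI2_ex) simp
  have "(M ** matrix_inv (blkA \<Phi> n)) ** blkA \<Phi> n = M" for M :: "('a \<times> 'a) cmat"
    by (simp add: inv flip: matrix_mul_assoc)
  then show ?thesis
    by (cases n) simp_all
qed


section \<open>Complex measures on the real line and weight matrices\<close>

definition complex_measure :: "(real set \<Rightarrow> complex) \<Rightarrow> bool" where
  "complex_measure \<nu> \<longleftrightarrow> (\<forall>S :: nat \<Rightarrow> real set. range S \<subseteq> sets borel \<longrightarrow> disjoint_family S \<longrightarrow>
     (\<lambda>k. \<nu> (S k)) sums \<nu> (\<Union>k. S k))"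

(* m 0 - m 2 and m 1 - m 3 represent the real and imaginary parts of the complex measure as
   differences of finite positive measures, not necessarily mutually singular. *)
definition cm_decomposition :: "(real set \<Rightarrow> complex) \<Rightarrow> (nat \<Rightarrow> real measure) \<Rightarrow> bool" where
  "cm_decomposition \<nu> m \<longleftrightarrow> (\<forall>k<4. finite_measure (m k) \<and> sets (m k) = sets borel) \<and>
     (\<forall>S\<in>sets borel. \<nu> S = (\<Sum>k<4. \<i> ^ k * of_real (measure (m k) S)))"

(* Equivalent to integrability of |f| against the total variation of the complex measure,
   which is dominated by m 0 + m 1 + m 2 + m 3, while the Jordan decompositions of the real and
   imaginary parts are dominated by the total variation. The integral does not depend on the
   decomposition, see has_cm_integral_unique. *)
definition has_cm_integral :: "(real set \<Rightarrow> complex) \<Rightarrow> (real \<Rightarrow> complex) \<Rightarrow> complex \<Rightarrow> bool" where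
  "has_cm_integral \<nu> f I \<longleftrightarrow> (\<exists>m. cm_decomposition \<nu> m \<and> (\<forall>k<4. integrable (m k) f) \<and>
     I = (\<Sum>k<4. \<i> ^ k * (LINT x|m k. f x)))"

definition cm_integrable :: "(real set \<Rightarrow> complex) \<Rightarrow> (real \<Rightarrow> complex) \<Rightarrow> bool" where
  "cm_integrable \<nu> f \<longleftrightarrow> (\<exists>I. has_cm_integral \<nu> f I)"

definition cm_integral :: "(real set \<Rightarrow> complex) \<Rightarrow> (real \<Rightarrow> complex) \<Rightarrow> complex" where
  "cm_integral \<nu> f = (THE I. has_cm_integral \<nu> f I)"

lemma nn_integral_cross_add:
  fixes f :: "real \<Rightarrow> ennreal"
  assumes sets: "sets M1 = sets borel" "sets M2 = sets borel" "sets M3 = sets borel" "sets M4 = sets borel"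
    and eq: "\<And>S. S \<in> sets borel \<Longrightarrow> emeasure M1 S + emeasure M2 S = emeasure M3 S + emeasure M4 S"
    and f: "f \<in> borel_measurable borel"
  shows "nn_integral M1 f + nn_integral M2 f = nn_integral M3 f + nn_integral M4 f"
proof -
  have meas: "g \<in> borel_measurable M1" "g \<in> borel_measurable M2"
    "g \<in> borel_measurable M3" "g \<in> borel_measurable M4"
    if "g \<in> borel_measurable borel" for g :: "real \<Rightarrow> ennreal"
    using that sets by (simp_all cong: measurable_cong_sets)
  from f show ?thesis
  proof (induction rule: borel_measurable_induct)
    case (cong f g)
    then have "f = g" by auto
    with cong show ?case by simp
  next
    case (set A)
    then show ?case using eq sets by simp
  next
    case (mult u c)
    then show ?case by (simp add: nn_integral_cmult meas flip: distrib_left)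
  next
    case (add u v)
    have "(nn_integral M1 v + nn_integral M2 v) + (nn_integral M1 u + nn_integral M2 u)
        = (nn_integral M3 v + nn_integral M4 v) + (nn_integral M3 u + nn_integral M4 u)"
      using add by simp
    then show ?case using add by (simp add: nn_integral_add meas ac_simps)
  next
    case (seq U)
    have *: "(SUP i. nn_integral M (U i)) + (SUP i. nn_integral M' (U i))
        = (SUP i. nn_integral M (U i) + nn_integral M' (U i))" for M M' :: "real measure"
      using seq by (intro ennreal_SUP_add[symmetric])
        (auto simp: incseq_def le_fun_def intro!: nn_integral_mono)
    have **: "nn_integral M (SUP i. U i) = (SUP i. nn_integral M (U i))"
      if "sets M = sets borel" for M :: "real measure"
    proof -
      have "U i \<in> borel_measurable M" for i
        using seq that by (simp cong: measurable_cong_sets)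
      from nn_integral_monotone_convergence_SUP[OF seq(3) this]
      show ?thesis by (simp add: SUP_apply[abs_def])
    qed
    show ?case using seq by (simp add: ** sets * del: Sup_apply SUP_apply)
  qed
qed

lemma integral_cross_add:
  fixes f :: "real \<Rightarrow> complex"
  assumes sets: "sets M1 = sets borel" "sets M2 = sets borel" "sets M3 = sets borel" "sets M4 = sets borel"
    and fin: "finite_measure M1" "finite_measure M2" "finite_measure M3" "finite_measure M4"
    and eq: "\<And>S. S \<in> sets borel \<Longrightarrow> measure M1 S + measure M2 S = measure M3 S + measure M4 S"
    and int: "integrable M1 f" "integrable M2 f" "integrable M3 f" "integrable M4 f"
  shows "integral\<^sup>L M1 f + integral\<^sup>L M2 f = integral\<^sup>L M3 f + integral\<^sup>L M4 f"
proof -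
  have eq': "emeasure M1 S + emeasure M2 S = emeasure M3 S + emeasure M4 S" if "S \<in> sets borel" for S
    using eq[OF that] fin by (simp add: finite_measure.emeasure_eq_measure flip: ennreal_plus)
  have f: "f \<in> borel_measurable borel"
    using borel_measurable_integrable[OF int(1)] sets(1) by (simp cong: measurable_cong_sets)
  have real: "integral\<^sup>L M1 g + integral\<^sup>L M2 g = integral\<^sup>L M3 g + integral\<^sup>L M4 g"
    if g: "integrable M1 g" "integrable M2 g" "integrable M3 g" "integrable M4 g"
      "g \<in> borel_measurable borel" for g :: "real \<Rightarrow> real"
  proof -
    have part: "enn2real (nn_integral M1 (\<lambda>x. ennreal (h x))) + enn2real (nn_integral M2 (\<lambda>x. ennreal (h x)))
        = enn2real (nn_integral M3 (\<lambda>x. ennreal (h x))) + enn2real (nn_integral M4 (\<lambda>x. ennreal (h x)))"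
      if h: "integrable M1 h" "integrable M2 h" "integrable M3 h" "integrable M4 h"
        "h \<in> borel_measurable borel" for h :: "real \<Rightarrow> real"
    proof -
      have fin': "nn_integral M (\<lambda>x. ennreal (h x)) \<noteq> \<infinity>" if "integrable M h" for M :: "real measure"
        using that by (simp add: real_integrable_def)
      have "nn_integral M1 (\<lambda>x. ennreal (h x)) + nn_integral M2 (\<lambda>x. ennreal (h x))
          = nn_integral M3 (\<lambda>x. ennreal (h x)) + nn_integral M4 (\<lambda>x. ennreal (h x))"
        using h(5) by (intro nn_integral_cross_add[OF sets eq']) auto
      then show ?thesis
        using fin'[OF h(1)] fin'[OF h(2)] fin'[OF h(3)] fin'[OF h(4)]
        by (simp add: less_top flip: enn2real_plus)
    qed
    from part[OF g] part[of "\<lambda>x. - g x"] g show ?thesis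
      by (simp add: real_lebesgue_integral_def)
  qed
  have "(LINT x|M1. Re (f x)) + (LINT x|M2. Re (f x)) = (LINT x|M3. Re (f x)) + (LINT x|M4. Re (f x))"
    using int f by (intro real) auto
  moreover
  have "(LINT x|M1. Im (f x)) + (LINT x|M2. Im (f x)) = (LINT x|M3. Im (f x)) + (LINT x|M4. Im (f x))"
    using int f by (intro real) auto
  ultimately show ?thesis
    using int by (simp add: complex_eq_iff)
qed

lemma has_cm_integral_unique:
  assumes "has_cm_integral \<nu> f I" "has_cm_integral \<nu> f J"
  shows "I = J"
proof -
  have sum4: "(\<Sum>k<4. g k) = g 0 + g 1 + g 2 + g (3::nat)" for g :: "nat \<Rightarrow> complex"
    by (simp add: eval_nat_numeral)
  have i3: "\<i> ^ 3 = - \<i>" by (simp add: eval_nat_numeral)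
  obtain m where m: "cm_decomposition \<nu> m" "\<And>k. k < 4 \<Longrightarrow> integrable (m k) f"
    and I: "I = (\<Sum>k<4. \<i> ^ k * (LINT x|m k. f x))"
    using assms(1) unfolding has_cm_integral_def by blast
  obtain n where n: "cm_decomposition \<nu> n" "\<And>k. k < 4 \<Longrightarrow> integrable (n k) f"
    and J: "J = (\<Sum>k<4. \<i> ^ k * (LINT x|n k. f x))"
    using assms(2) unfolding has_cm_integral_def by blast
  have base: "sets (m k) = sets borel" "sets (n k) = sets borel"
    "finite_measure (m k)" "finite_measure (n k)" if "k < 4" for k
    using m(1) n(1) that by (auto simp: cm_decomposition_def)
  have eq: "measure (m 0) S + measure (n 2) S = measure (n 0) S + measure (m 2) S"
    "measure (m 1) S + measure (n 3) S = measure (n 1) S + measure (m 3) S"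
    if "S \<in> sets borel" for S
  proof -
    have "(\<Sum>k<4. \<i> ^ k * complex_of_real (measure (m k) S)) = (\<Sum>k<4. \<i> ^ k * complex_of_real (measure (n k) S))"
      using m(1) n(1) that by (simp add: cm_decomposition_def)
    then show "measure (m 0) S + measure (n 2) S = measure (n 0) S + measure (m 2) S"
      "measure (m 1) S + measure (n 3) S = measure (n 1) S + measure (m 3) S"
      by (simp_all add: sum4 i3 complex_eq_iff)
  qed
  have "(LINT x|m 0. f x) + (LINT x|n 2. f x) = (LINT x|n 0. f x) + (LINT x|m 2. f x)"
    by (intro integral_cross_add base eq m n) auto
  moreover have "(LINT x|m 1. f x) + (LINT x|n 3. f x) = (LINT x|n 1. f x) + (LINT x|m 3. f x)"
    by (intro integral_cross_add base eq m n) auto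
  ultimately show ?thesis
    unfolding I J sum4 i3 by (simp add: algebra_simps) algebra
qed

definition weight_matrix :: "(real set \<Rightarrow> 'm::finite cmat) \<Rightarrow> bool" where
  "weight_matrix W \<longleftrightarrow> (\<forall>c d. complex_measure (\<lambda>S. W S $ c $ d)) \<and>
     (\<forall>c d n. cm_integrable (\<lambda>S. W S $ c $ d) (\<lambda>x. of_real (x ^ n))) \<and>
     (\<forall>S\<in>sets borel. psd (W S))"

(* The matrix integral of F* dW G, entry by entry. *)
definition weight_integral :: "(real set \<Rightarrow> 'm::finite cmat) \<Rightarrow> (real \<Rightarrow> 'm cmat) \<Rightarrow> (real \<Rightarrow> 'm cmat) \<Rightarrow> 'm cmat" where
  "weight_integral W F G = (\<chi> a b. \<Sum>c\<in>UNIV. \<Sum>d\<in>UNIV.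
     cm_integral (\<lambda>S. W S $ c $ d) (\<lambda>x. mstar (F x) $ a $ c * G x $ d $ b))"

definition admits_weight_matrix :: "'n::finite qmc \<Rightarrow> (real set \<Rightarrow> ('n \<times> 'n) cmat) \<Rightarrow> bool" where
  "admits_weight_matrix \<Phi> W \<longleftrightarrow> weight_matrix W \<and>
     (\<forall>i. invertible (weight_integral W (qpoly \<Phi> i) (qpoly \<Phi> i))) \<and>
     (\<forall>i j n. bpow (qmc_rep \<Phi>) n i j =
        matrix_inv (weight_integral W (qpoly \<Phi> i) (qpoly \<Phi> i)) **
        weight_integral W (qpoly \<Phi> i) (\<lambda>x. x ^ n *\<^sub>R qpoly \<Phi> j x))"

end

theory Submission
  imports Defs
begin

text \<open>Boundedness of the powers of \<open>\<Phi>\<close> on the block \<open>(0, 0)\<close> bounds the moments of \<open>W\<close>, so \<open>W\<close> is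
  supported in \<open>[-1, 1]\<close>, where \<open>(x\<^sup>n + x\<^sup>n\<^sup>+\<^sup>1) / 2\<close> converges boundedly to the indicator of \<open>{1}\<close>. Hence
  the \<open>(i, j)\<close> block of \<open>(\<Phi>\<^sup>n + \<Phi>\<^sup>n\<^sup>+\<^sup>1) / 2\<close> tends to \<open>E\<^sub>i\<^sub>j = (\<integral>Q\<^sub>i\<^sup>* dW Q\<^sub>i)\<^sup>-\<^sup>1 Q\<^sub>i(1)\<^sup>* W({1}) Q\<^sub>j(1)\<close>.
  If \<open>W({1}) \<noteq> 0\<close>, then \<open>E\<^sub>0\<^sub>0 \<noteq> 0\<close>, and for a positive \<open>X\<close> with \<open>E\<^sub>0\<^sub>0 X \<noteq> 0\<close> the column \<open>(E\<^sub>i\<^sub>0 X)\<^sub>i\<close> is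
  positive, invariant, nonzero and, by Fatou, of finite trace. If \<open>W({1}) = 0\<close>, then all \<open>E\<^sub>i\<^sub>j\<close> vanish,
  and dominated convergence over the vertices shows that an invariant distribution would have trace
  zero.\<close>

section \<open>Positive semidefinite matrices\<close>

text \<open>The expression is the quadratic form of \<open>A\<close> at e_i + z e_j. The test vector
  adds the two contributions, so the case i = j needs no separate treatment.\<close>

lemma psd_two_points:
  assumes "psd A"
  shows "A $ i $ i + z * A $ i $ j + cnj z * A $ j $ i + cnj z * z * A $ j $ j \<in> \<real>\<^sub>\<ge>\<^sub>0"
proof -
  define v where "v = (\<chi> k. (if k = i then 1 else 0) + (if k = j then z else 0))"
  have *: "(\<Sum>k\<in>UNIV. f k * v $ k) = f i + f j * z"
    "(\<Sum>k\<in>UNIV. cnj (v $ k) * f k) = f i + cnj z * f j" for f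
    by (simp_all add: v_def algebra_simps sum.distrib if_distrib[of cnj] if_distrib[of "(*) _"]
      if_distrib[of "\<lambda>x. x * _"] cong: if_cong)
  have "(\<Sum>k\<in>UNIV. \<Sum>l\<in>UNIV. cnj (v $ k) * A $ k $ l * v $ l) \<in> \<real>\<^sub>\<ge>\<^sub>0"
    using assms by (simp add: psd_def)
  then show ?thesis
    by (simp add: * mult.assoc flip: sum_distrib_left) (simp add: algebra_simps)
qed

lemma psd_diag: "psd A \<Longrightarrow> A $ i $ i \<in> \<real>\<^sub>\<ge>\<^sub>0"
  using psd_two_points[of A i 0 i] by simp

text \<open>Obtained by testing the quadratic form on \<open>e\<^sub>i + z e\<^sub>j\<close> for the fourth roots of unity \<open>z\<close>.\<close>

lemma psd_entry_le:
  assumes "psd A"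
  shows "norm (A $ i $ j) \<le> Re (A $ i $ i) + Re (A $ j $ j)"
proof -
  let ?s = "Re (A $ i $ i) + Re (A $ j $ j)"
  have d: "Im (A $ i $ i) = 0" "Im (A $ j $ j) = 0"
    using psd_diag[OF assms] by (auto simp: complex_nonneg_Reals_iff)
  note q = psd_two_points[OF assms, of i _ j]
  have "norm (A $ i $ j + A $ j $ i) \<le> ?s"
    using q[of 1] q[of "-1"] d by (auto simp: complex_nonneg_Reals_iff cmod_eq_Re)
  moreover have "norm (\<i> * (A $ i $ j - A $ j $ i)) \<le> ?s"
    using q[of "\<i>"] q[of "-\<i>"] d by (auto simp: complex_nonneg_Reals_iff cmod_eq_Re)
  moreover have "2 * norm (A $ i $ j) = norm ((A $ i $ j + A $ j $ i) + (A $ i $ j - A $ j $ i))"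
    by (simp add: norm_mult)
  ultimately show ?thesis
    using norm_triangle_ineq[of "A $ i $ j + A $ j $ i" "A $ i $ j - A $ j $ i"]
    by (simp add: norm_mult)
qed

lemma psd_trace: "psd A \<Longrightarrow> trace A \<in> \<real>\<^sub>\<ge>\<^sub>0"
  using psd_diag[of A] by (auto simp: trace_def complex_nonneg_Reals_iff intro!: sum_nonneg)

lemma psd_Re_diag_le_trace:
  assumes "psd A"
  shows "Re (A $ i $ i) \<le> Re (trace A)"
  using psd_diag[OF assms] by (auto simp: trace_def complex_nonneg_Reals_iff intro!: member_le_sum)

text \<open>This turns bounds on traces, which the chain preserves, into bounds on all
  entries.\<close>

lemma psd_norm_entry_le_trace: "psd A \<Longrightarrow> norm (A $ i $ j) \<le> 2 * Re (trace A)"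
  using psd_entry_le[of A i j] psd_Re_diag_le_trace[of A i] psd_Re_diag_le_trace[of A j] by simp

lemma psd_trace_eq_0:
  assumes "psd A" "trace A = 0"
  shows "A = 0"
proof -
  have "norm (A $ i $ j) \<le> 0" for i j
    using psd_norm_entry_le_trace[OF assms(1), of i j] assms(2) by simp
  then show ?thesis by (simp add: vec_eq_iff)
qed

lemma psd_0 [simp]: "psd 0"
  by (simp add: psd_def)

lemma psd_add: "psd A \<Longrightarrow> psd B \<Longrightarrow> psd (A + B)"
  by (simp add: psd_def algebra_simps sum.distrib)

lemma psd_sum: "(\<And>x. x \<in> S \<Longrightarrow> psd (f x)) \<Longrightarrow> psd (sum f S)"
  by (induction S rule: infinite_finite_induct) (auto intro: psd_add)

lemma psd_scaleR:
  assumes "psd A" "0 \<le> r"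
  shows "psd (r *\<^sub>R A)"
proof -
  have "cnj (v $ i) * (r *\<^sub>R A) $ i $ j * v $ j = of_real r * (cnj (v $ i) * A $ i $ j * v $ j)" for v i j
    by (simp add: scaleR_conv_of_real[where 'a=complex])
  then show ?thesis
    using assms by (auto simp: psd_def simp flip: sum_distrib_left)
qed

lemma psd_limit:
  assumes "X \<longlonglongrightarrow> Y" "\<And>n. psd (X n)"
  shows "psd Y"
  unfolding psd_def
proof
  fix v
  have "(\<lambda>n. \<Sum>i\<in>UNIV. \<Sum>j\<in>UNIV. cnj (v $ i) * X n $ i $ j * v $ j)
      \<longlonglongrightarrow> (\<Sum>i\<in>UNIV. \<Sum>j\<in>UNIV. cnj (v $ i) * Y $ i $ j * v $ j)"
    by (intro tendsto_intros assms)
  then show "(\<Sum>i\<in>UNIV. \<Sum>j\<in>UNIV. cnj (v $ i) * Y $ i $ j * v $ j) \<in> \<real>\<^sub>\<ge>\<^sub>0"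
    using assms(2) by (intro Lim_in_closed_set[OF closed_nonneg_Reals_complex]) (auto simp: psd_def)
qed

section \<open>Rank-one positive matrices and how they determine a linear map\<close>

definition outer :: "complex^'n \<Rightarrow> 'n cmat" where
  "outer u = (\<chi> a b. u $ a * cnj (u $ b))"

lemma psd_outer: "psd (outer u)"
proof -
  have "(\<Sum>i\<in>UNIV. \<Sum>j\<in>UNIV. cnj (v $ i) * outer u $ i $ j * v $ j)
      = (\<Sum>i\<in>UNIV. cnj (v $ i) * u $ i) * cnj (\<Sum>i\<in>UNIV. cnj (v $ i) * u $ i)" for v
    by (simp add: outer_def sum_product ac_simps)
  moreover have "z * cnj z \<in> \<real>\<^sub>\<ge>\<^sub>0" for z
    by (simp add: complex_nonneg_Reals_iff)
  ultimately show ?thesis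
    by (simp add: psd_def del: cnj_sum)
qed

text \<open>Polarisation: the matrix unit \<open>E\<^sub>i\<^sub>j\<close> is a combination of four positive matrices.\<close>

lemma column_eq_psd_combination:
  obtains P :: "nat \<Rightarrow> 'n::finite cmat" where "\<And>k. psd (P k)"
    and "\<And>(M :: ('n \<times> 'n) cmat) p. M $ p $ (i, j) = (\<Sum>k<4. \<i> ^ k * (M *v rvec (P k)) $ p) / 4"
proof
  define P where "P k = outer (\<chi> a. (if a = i then 1 else 0) + \<i> ^ k * (if a = j then 1 else 0))" for k
  show "psd (P k)" for k by (simp add: P_def psd_outer)
  fix M :: "('n \<times> 'n) cmat" and p
  have sum4: "(\<Sum>k<4. g k) = g 0 + g 1 + g 2 + g (3::nat)" for g :: "nat \<Rightarrow> complex"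
    by (simp add: eval_nat_numeral)
  have i3: "\<i> ^ 3 = - \<i>" by (simp add: eval_nat_numeral)
  \<comment> \<open>Expanding \<open>P k\<close> into four matrix units, only the one at (i, j)
    carries the factor cnj (\<i> ^ k); the weights \<i> ^ k isolate it, since the other powers of
    \<i> sum to zero over k < 4.\<close>
  have unit: "(\<Sum>k<4. \<i> ^ k * rvec (P k) $ q) = (if q = (i, j) then 4 else 0)" for q
    by (cases q) (simp add: sum4 i3 P_def outer_def rvec_def)
  have "(\<Sum>k<4. \<i> ^ k * (M *v rvec (P k)) $ p)
      = (\<Sum>q\<in>UNIV. M $ p $ q * (\<Sum>k<4. \<i> ^ k * rvec (P k) $ q))"
    by (simp add: matrix_vector_mult_def sum_distrib_left) (subst sum.swap, simp add: ac_simps)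
  also have "\<dots> = 4 * M $ p $ (i, j)"
    by (simp add: unit if_distrib[of "(*) _"] cong: if_cong)
  finally show "M $ p $ (i, j) = (\<Sum>k<4. \<i> ^ k * (M *v rvec (P k)) $ p) / 4" by simp
qed

text \<open>Positive matrices span the whole matrix space, so a nonzero linear map cannot vanish on
  all of them.\<close>

lemma psd_detects_nonzero:
  fixes M :: "('n::finite \<times> 'n) cmat"
  assumes "M \<noteq> 0"
  obtains X :: "'n cmat" where "psd X" "M *v rvec X \<noteq> 0"
proof -
  obtain p i j where "M $ p $ (i, j) \<noteq> 0"
    using assms by (auto simp: vec_eq_iff)
  moreover obtain P :: "nat \<Rightarrow> 'n cmat" where "\<And>k. psd (P k)"
    and "\<And>(M :: ('n \<times> 'n) cmat) p. M $ p $ (i, j) = (\<Sum>k<4. \<i> ^ k * (M *v rvec (P k)) $ p) / 4"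
    using column_eq_psd_combination[of i j] by blast
  ultimately show ?thesis
    by (metis (no_types, lifting) that div_0 mult_zero_right sum.neutral zero_index)
qed

text \<open>By polarisation each entry is controlled by the images of four positive matrices;
  summing the finitely many entrywise bounds makes the constant uniform.\<close>

lemma matrix_bounded_if_psd_bounded:
  fixes M :: "nat \<Rightarrow> ('n::finite \<times> 'n) cmat"
  assumes "\<And>X :: 'n cmat. psd X \<Longrightarrow> \<exists>C. \<forall>n. norm (M n *v rvec X) \<le> C"
  obtains C where "\<And>n p q. norm (M n $ p $ q) \<le> C"
proof -
  have "\<exists>C. \<forall>n. norm (M n $ p $ q) \<le> C" for p q
  proof (cases q)
    case (Pair i j)
    obtain P :: "nat \<Rightarrow> 'n cmat" where P: "\<And>k. psd (P k)"
      and M: "\<And>(M :: ('n \<times> 'n) cmat) p. M $ p $ (i, j) = (\<Sum>k<4. \<i> ^ k * (M *v rvec (P k)) $ p) / 4"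
      using column_eq_psd_combination[of i j] by blast
    obtain C where C: "\<And>k n. norm (M n *v rvec (P k)) \<le> C k"
      using assms[OF P] by metis
    have "norm (M n $ p $ q) \<le> (\<Sum>k<4. C k)" for n
    proof -
      have "norm (\<Sum>k<4. \<i> ^ k * (M n *v rvec (P k)) $ p) \<le> (\<Sum>k<4. C k)"
        by (rule sum_norm_le)
          (simp add: norm_mult norm_power order_trans[OF Finite_Cartesian_Product.norm_nth_le C])
      then show ?thesis
        using norm_ge_zero[of "\<Sum>k<4. \<i> ^ k * (M n *v rvec (P k)) $ p"]
        unfolding Pair M norm_divide norm_numeral by linarith
    qed
    then show ?thesis by blast
  qed
  then obtain C where C: "\<And>p q n. norm (M n $ p $ q) \<le> C p q" by metis
  have "norm (M n $ p $ q) \<le> (\<Sum>p\<in>UNIV. \<Sum>q\<in>UNIV. C p q)" for n p q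
  proof -
    have nonneg: "0 \<le> C p q" for p q using order_trans[OF norm_ge_zero C] .
    have "C p q \<le> (\<Sum>q\<in>UNIV. C p q)"
      by (rule member_le_sum) (simp_all add: nonneg)
    moreover have "(\<Sum>q\<in>UNIV. C p q) \<le> (\<Sum>p\<in>UNIV. \<Sum>q\<in>UNIV. C p q)"
      by (rule member_le_sum) (simp_all add: nonneg sum_nonneg)
    ultimately show ?thesis using C[of n p q] by linarith
  qed
  then show thesis by (rule that)
qed

section \<open>Evolution of a block tridiagonal chain\<close>

lemma psd_block_1: "psd_block (Suc 0) (\<lambda>_ _. X) \<longleftrightarrow> psd X"
proof
  assume block: "psd_block (Suc 0) (\<lambda>_ _. X)"
  show "psd X"
    unfolding psd_def
  proof
    fix v
    show "(\<Sum>i\<in>UNIV. \<Sum>j\<in>UNIV. cnj (v $ i) * X $ i $ j * v $ j) \<in> \<real>\<^sub>\<ge>\<^sub>0"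
      using block[unfolded psd_block_def, rule_format, of "\<lambda>_. v"] by simp
  qed
qed (simp add: psd_block_def psd_def)

text \<open>Complete positivity at block size one is ordinary positivity.\<close>

lemma completely_positive_psd:
  assumes "completely_positive T" "psd X"
  shows "psd (T X)"
proof -
  have "psd_block (Suc 0) (\<lambda>_ _. X) \<longrightarrow> psd_block (Suc 0) (\<lambda>_ _. T X)"
    using assms(1)[unfolded completely_positive_def, THEN conjunct2, THEN spec, THEN spec, of _ "\<lambda>_ _. X"] .
  then show ?thesis using assms(2) by (simp only: psd_block_1)
qed

section \<open>Linearity and continuity on matrices\<close>

lemma clinear_map_add: "clinear_map T \<Longrightarrow> T (X + Y) = T X + T Y"
  by (simp add: clinear_map_def)

lemma clinear_map_scaleR:
  assumes "clinear_map T"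
  shows "T (r *\<^sub>R X) = r *\<^sub>R T X"
proof -
  have *: "(\<chi> i j. complex_of_real r * Z $ i $ j) = r *\<^sub>R Z" for Z :: "'a cmat"
    by (simp add: vec_eq_iff scaleR_conv_of_real[where 'a = complex])
  have "T (\<chi> i j. complex_of_real r * X $ i $ j) = (\<chi> i j. complex_of_real r * T X $ i $ j)"
    using assms[unfolded clinear_map_def, THEN conjunct2, THEN spec, THEN spec] .
  then show ?thesis unfolding * .
qed

lemma clinear_map_0: "clinear_map T \<Longrightarrow> T 0 = 0"
  using clinear_map_scaleR[of T 0] by simp

lemma clinear_map_sum: "clinear_map T \<Longrightarrow> T (sum f S) = (\<Sum>x\<in>S. T (f x))"
  by (induction S rule: infinite_finite_induct) (simp_all add: clinear_map_0[of T] clinear_map_add[of T])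

lemma tendsto_matrix_vector_mult:
  fixes M :: "'b \<Rightarrow> complex^'n^'m"
  assumes "(M \<longlongrightarrow> L) F" "(v \<longlongrightarrow> w) F"
  shows "((\<lambda>x. M x *v v x) \<longlongrightarrow> L *v w) F"
  unfolding matrix_vector_mult_def by (intro tendsto_intros assms)

lemma tendsto_matrix_matrix_mult:
  fixes M :: "'b \<Rightarrow> complex^'n::finite^'m"
  assumes "(M \<longlongrightarrow> L) F" "(M' \<longlongrightarrow> L') F"
  shows "((\<lambda>x. M x ** M' x) \<longlongrightarrow> L ** L') F"
  unfolding matrix_matrix_mult_def by (intro tendsto_intros assms)

lemma tendsto_unrvec: "(v \<longlongrightarrow> w) F \<Longrightarrow> ((\<lambda>x. unrvec (v x)) \<longlongrightarrow> unrvec w) F"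
  unfolding unrvec_def by (intro tendsto_intros)

lemma tendsto_rvec: "(X \<longlongrightarrow> Y) F \<Longrightarrow> ((\<lambda>x. rvec (X x)) \<longlongrightarrow> rvec Y) F"
  unfolding rvec_def by (intro tendsto_intros)

lemma tendsto_trace: "(X \<longlongrightarrow> Y) F \<Longrightarrow> ((\<lambda>x. trace (X x :: 'n::finite cmat)) \<longlongrightarrow> trace Y) F"
  unfolding trace_def by (intro tendsto_intros)

lemma tendsto_clinear_map:
  assumes "clinear_map T" "(X \<longlongrightarrow> Y) F"
  shows "((\<lambda>x. T (X x)) \<longlongrightarrow> T Y) F"
proof -
  have "((\<lambda>x. unrvec (matrix_rep T *v rvec (X x))) \<longlongrightarrow> unrvec (matrix_rep T *v rvec Y)) F"
    by (intro tendsto_unrvec tendsto_matrix_vector_mult tendsto_const tendsto_rvec assms)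
  then show ?thesis
    by (simp flip: rvec_matrix_rep[OF assms(1)])
qed

lemma trace_scaleR: "trace (r *\<^sub>R X :: 'n::finite cmat) = r *\<^sub>R trace X"
  by (simp add: trace_def scaleR_sum_right)

lemma trace_zero [simp]: "trace (0 :: 'n::finite cmat) = 0"
  by (simp add: trace_def)

lemma trace_sum: "trace (sum f S :: 'n::finite cmat) = (\<Sum>x\<in>S. trace (f x))"
  unfolding trace_def by simp (rule sum.swap)

section \<open>Columns evolving under the chain\<close>

locale tridiagonal_qmc =
  fixes \<Phi> :: "'n::finite qmc"
  assumes qmc: "is_qmc \<Phi>" and tridiagonal: "block_tridiagonal \<Phi>"
begin

abbreviation step :: "(nat \<Rightarrow> 'n cmat) \<Rightarrow> (nat \<Rightarrow> 'n cmat)" where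
  "step \<equiv> qmc_apply \<Phi>"

lemma cp: "completely_positive (\<Phi> i j)" and linear: "clinear_map (\<Phi> i j)"
  using qmc by (auto simp: is_qmc_def completely_positive_def)

lemma block_zero: "i > Suc j \<or> j > Suc i \<Longrightarrow> \<Phi> i j X = 0"
  using tridiagonal unfolding block_tridiagonal_def by metis

text \<open>Row i involves only vertices up to i + 1, so the series is finite. The bound
  \<open>m\<close> is left free so that sums for different rows can share one range.\<close>

lemma step_eq:
  assumes "Suc i \<le> m"
  shows "step \<rho> i = (\<Sum>k\<le>m. \<Phi> i k (\<rho> k))"
  unfolding qmc_apply_def using assms by (intro suminf_finite) (auto intro!: block_zero)

lemma trace_column:
  assumes "Suc j \<le> m"
  shows "(\<Sum>i\<le>m. trace (\<Phi> i j X)) = trace X"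
proof -
  have "(\<Sum>i. \<Phi> i j X) = (\<Sum>i\<le>m. \<Phi> i j X)"
    using assms by (intro suminf_finite) (auto intro!: block_zero)
  moreover have "trace (\<Sum>i. \<Phi> i j X) = trace X"
    using qmc unfolding is_qmc_def by blast
  ultimately show ?thesis
    by (simp add: trace_sum)
qed

lemma psd_step: "(\<And>k. psd (\<rho> k)) \<Longrightarrow> psd (step \<rho> i)"
  unfolding step_eq[OF order_refl] by (intro psd_sum completely_positive_psd[OF cp])

lemma psd_iterate: "(\<And>k. psd (\<rho> k)) \<Longrightarrow> psd ((step ^^ n) \<rho> i)"
  by (induction n arbitrary: i) (simp_all add: psd_step)

text \<open>Finite propagation speed: in n steps, vertex i is influenced only by vertices up to i +
  n.\<close>

lemma iterate_cong: "(\<And>k. k \<le> i + n \<Longrightarrow> \<rho> k = \<sigma> k) \<Longrightarrow> (step ^^ n) \<rho> i = (step ^^ n) \<sigma> i"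
proof (induction n arbitrary: i)
  case (Suc n)
  have "(step ^^ n) \<rho> k = (step ^^ n) \<sigma> k" if "k \<le> Suc i" for k
    using that Suc.prems by (intro Suc.IH) simp
  then show ?case by (simp add: step_eq[OF order_refl, where \<rho> = "(step ^^ n) _"] del: sum.atMost_Suc)
qed simp

lemma iterate_sum:
  "(step ^^ n) (\<lambda>k. \<Sum>x\<in>S. \<rho> x k) i = (\<Sum>x\<in>S. (step ^^ n) (\<rho> x) i)"
proof (induction n arbitrary: i)
  case (Suc n)
  then show ?case
    by (simp add: step_eq[OF order_refl, where \<rho> = "(step ^^ n) _"] clinear_map_sum[OF linear] del: sum.atMost_Suc)
      (rule sum.swap)
qed simp

lemma step_scaleR: "step (\<lambda>k. r *\<^sub>R \<rho> k) i = r *\<^sub>R step \<rho> i"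
  by (simp add: step_eq[OF order_refl] clinear_map_scaleR[OF linear] scaleR_sum_right del: sum.atMost_Suc)

lemma step_add: "step (\<lambda>k. \<rho> k + \<sigma> k) i = step \<rho> i + step \<sigma> i"
  by (simp add: step_eq[OF order_refl] clinear_map_add[OF linear] sum.distrib del: sum.atMost_Suc)

lemma tendsto_step:
  assumes "\<And>k. ((\<lambda>x. \<rho> x k) \<longlongrightarrow> \<sigma> k) F"
  shows "((\<lambda>x. step (\<rho> x) i) \<longlongrightarrow> step \<sigma> i) F"
  unfolding step_eq[OF order_refl] 
  by (rule tendsto_sum, rule tendsto_clinear_map[OF linear], rule assms)

lemma iterate_support:
  assumes "\<And>k. k > m \<Longrightarrow> \<rho> k = 0"
  shows "i > m + n \<Longrightarrow> (step ^^ n) \<rho> i = 0"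
proof (induction n arbitrary: i)
  case (Suc n)
  have "\<Phi> i k ((step ^^ n) \<rho> k) = 0" for k
    using Suc by (cases "k > m + n") (auto simp: clinear_map_0[OF linear] block_zero)
  then show ?case by (simp add: step_eq[OF order_refl, where \<rho> = "(step ^^ n) _"] del: sum.atMost_Suc)
qed (simp add: assms)

text \<open>The support of a finitely supported column grows by at most one vertex per step, so the
  range {..m + n} always carries the full trace, which each column sum of \<Phi> preserves.\<close>

lemma trace_iterate:
  assumes "\<And>k. k > m \<Longrightarrow> \<rho> k = 0"
  shows "(\<Sum>i\<le>m + n. trace ((step ^^ n) \<rho> i)) = (\<Sum>i\<le>m. trace (\<rho> i))"
proof (induction n)
  case (Suc n)
  let ?\<sigma> = "(step ^^ n) \<rho>"
  \<comment> \<open>One summation range serves every row i, which permits exchanging the two sums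
    below. The intermediate bound \<open>Suc i + (m + n)\<close> is large enough for
    \<open>step_eq\<close>, and its excess terms vanish because \<open>?\<sigma>\<close> is
    supported in {..m + n}.\<close>
  have s: "step ?\<sigma> i = (\<Sum>k\<le>m + n. \<Phi> i k (?\<sigma> k))" for i
  proof -
    have "\<Phi> i k (?\<sigma> k) = 0" if "k > m + n" for k
      using that by (simp add: iterate_support[OF assms] clinear_map_0[OF linear])
    then have "(\<Sum>k\<le>Suc i + (m + n). \<Phi> i k (?\<sigma> k)) = (\<Sum>k\<le>m + n. \<Phi> i k (?\<sigma> k))"
      by (intro sum.mono_neutral_right) auto
    then show ?thesis by (subst step_eq[of i "Suc i + (m + n)"]) simp_all
  qed
  have "(\<Sum>i\<le>m + Suc n. trace (step ?\<sigma> i)) = (\<Sum>k\<le>m + n. \<Sum>i\<le>m + Suc n. trace (\<Phi> i k (?\<sigma> k)))"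
    unfolding s trace_sum by (rule sum.swap)
  also have "\<dots> = (\<Sum>k\<le>m + n. trace (?\<sigma> k))"
    by (intro sum.cong refl trace_column) simp
  finally show ?case using Suc by simp
qed simp

definition point :: "nat \<Rightarrow> 'n cmat \<Rightarrow> nat \<Rightarrow> 'n cmat" where
  "point j X = (\<lambda>k. if k = j then X else 0)"

lemma psd_point: "psd X \<Longrightarrow> psd (point j X k)"
  by (simp add: point_def)

text \<open>The left side is part of a conserved total: all terms are nonnegative, so the range may
  be enlarged until it contains the whole support.\<close>

lemma trace_iterate_point_le:
  assumes "psd X"
  shows "(\<Sum>i\<le>m. Re (trace ((step ^^ n) (point j X) i))) \<le> Re (trace X)"
proof -
  let ?t = "\<lambda>i. Re (trace ((step ^^ n) (point j X) i))"
  have nn: "0 \<le> ?t i" for i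
    using psd_trace[OF psd_iterate[OF psd_point[OF assms]]] by (simp add: complex_nonneg_Reals_iff)
  \<comment> \<open>The support bound is taken as \<open>m + j\<close>: at least j, so it covers the
    starting vertex, and at least m, so the given range is contained in the enlarged one.\<close>
  have "(\<Sum>i\<le>m. ?t i) \<le> (\<Sum>i\<le>(m + j) + n. ?t i)"
    by (intro sum_mono2) (auto simp: nn)
  also have "\<dots> = Re (\<Sum>i\<le>m + j. trace (point j X i))"
    by (subst trace_iterate[symmetric, where n = n]) (auto simp: point_def)
  also have "(\<Sum>i\<le>m + j. trace (point j X i)) = trace X"
    by (simp add: point_def if_distrib[of trace] cong: if_cong)
  finally show ?thesis .
qed

text \<open>This links the evolution to the powers that the weight matrix describes. Tridiagonality
  makes the block products finite sums, so both sides satisfy the same recursion in n.\<close>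

lemma rvec_iterate_point:
  "rvec ((step ^^ n) (point j X) i) = bpow (qmc_rep \<Phi>) n i j *v rvec X"
proof (induction n arbitrary: i)
  case 0
  then show ?case by (simp add: point_def bone_def) (simp add: rvec_def vec_eq_iff)
next
  case (Suc n)
  have rvec_sum: "rvec (sum f S) = (\<Sum>x\<in>S. rvec (f x))" for f :: "nat \<Rightarrow> 'n cmat" and S
    by (simp add: rvec_def vec_eq_iff)
  have mult_sum: "sum M S *v v = (\<Sum>x\<in>S. M x *v v)"
    for M :: "nat \<Rightarrow> ('n \<times> 'n) cmat" and S and v :: "complex^('n \<times> 'n)"
    by (induction S rule: infinite_finite_induct) (simp_all add: matrix_vector_mult_add_rdistrib)
  have zero_mult: "(0 :: ('n \<times> 'n) cmat) ** M = 0" for M :: "('n \<times> 'n) cmat"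
    by (simp add: matrix_matrix_mult_def vec_eq_iff)
  have zero: "qmc_rep \<Phi> i k = 0" if "k > Suc i" for k
  proof -
    have "\<Phi> i k = (\<lambda>_. 0)" using that by (auto simp: block_zero)
    then show ?thesis
      by (simp add: qmc_rep_def matrix_rep_def matrix_def vec_eq_iff rvec_def)
  qed
  have "bpow (qmc_rep \<Phi>) (Suc n) i j = (\<Sum>k\<le>Suc i. qmc_rep \<Phi> i k ** bpow (qmc_rep \<Phi>) n k j)"
    unfolding bpow.simps bmult_def by (rule suminf_finite) (simp_all add: zero zero_mult)
  then show ?case
    by (simp add: step_eq[OF order_refl, where \<rho> = "(step ^^ n) _"] rvec_sum mult_sum rvec_matrix_rep[OF linear] Suc.IH
      qmc_rep_def matrix_vector_mul_assoc del: sum.atMost_Suc bpow.simps)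
qed

end

section \<open>Integrals of powers against a complex measure\<close>

lemma cm_integral_eq: "has_cm_integral \<nu> f I \<Longrightarrow> cm_integral \<nu> f = I"
  unfolding cm_integral_def by (blast intro: the_equality has_cm_integral_unique)

lemma sum_lessThan_4: "(\<Sum>k<4. g k) = g 0 + g 1 + g 2 + (g (3::nat) :: complex)"
  by (simp add: eval_nat_numeral)

lemma i_power_3: "\<i> ^ 3 = - \<i>"
  by (simp add: eval_nat_numeral)

text \<open>Markov's inequality with the even power \<open>2 * n\<close>, for a set function that is
  positive but given through a decomposition into four measures.\<close>

lemma tail_le_moment:
  assumes int: "cm_integrable \<nu> (\<lambda>x. of_real (x ^ (2 * n)))"
    and nonneg: "\<And>S. S \<in> sets borel \<Longrightarrow> \<nu> S \<in> \<real>\<^sub>\<ge>\<^sub>0"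
    and S: "S \<in> sets borel" "\<And>x. x \<in> S \<Longrightarrow> r \<le> \<bar>x\<bar>" and "0 \<le> r"
  shows "r ^ (2 * n) * Re (\<nu> S) \<le> Re (cm_integral \<nu> (\<lambda>x. of_real (x ^ (2 * n))))"
proof -
  obtain J where J: "has_cm_integral \<nu> (\<lambda>x. of_real (x ^ (2 * n))) J"
    using int unfolding cm_integrable_def by blast
  then obtain m where m: "cm_decomposition \<nu> m"
    and int_m: "\<And>k. k < 4 \<Longrightarrow> integrable (m k) (\<lambda>x. complex_of_real (x ^ (2 * n)))"
    and I: "J = (\<Sum>k<4. \<i> ^ k * (LINT x|m k. complex_of_real (x ^ (2 * n))))"
    unfolding has_cm_integral_def by blast
  note int_m = int_m[unfolded complex_of_real_integrable_eq]
  have sets: "sets (m k) = sets borel" and fin: "finite_measure (m k)" if "k < 4" for k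
    using m that by (auto simp: cm_decomposition_def)
  have \<nu>: "Re (\<nu> T) = measure (m 0) T - measure (m 2) T" if "T \<in> sets borel" for T
    using m that by (simp add: cm_decomposition_def sum_lessThan_4 i_power_3)
  \<comment> \<open>Nothing forces \<open>m 2\<close> to be zero, but positivity of
    \<open>\<nu>\<close> makes \<open>m 0\<close> dominate it; integrals of nonnegative functions
    then compare in the same direction.\<close>
  have "m 2 \<le> m 0"
  proof (subst le_measure)
    show "\<forall>T\<in>sets (m 2). emeasure (m 2) T \<le> emeasure (m 0) T"
      using nonneg \<nu> by (auto simp: sets fin finite_measure.emeasure_eq_measure complex_nonneg_Reals_iff
        intro!: ennreal_leI)
  qed (simp add: sets)
  define f where "f x = x ^ (2 * n) - r ^ (2 * n) * indicator S x" for x :: real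
  have f_nonneg: "0 \<le> f x" for x
  proof (cases "x \<in> S")
    case True
    then have "r ^ (2 * n) \<le> \<bar>x\<bar> ^ (2 * n)"
      using S \<open>0 \<le> r\<close> by (intro power_mono) auto
    then show ?thesis using True by (simp add: f_def power_even_abs)
  qed (simp add: f_def)
  have ind: "integrable (m k) (indicator S :: real \<Rightarrow> real)" "(LINT x|m k. indicator S x) = measure (m k) S"
    if "k < 4" for k
    using S sets[OF that] fin[OF that]
    by (auto simp: finite_measure.emeasure_finite less_top[symmetric] intro!: integrable_real_indicator)
  have int_f: "integrable (m k) f" if "k < 4" for k
    unfolding f_def using int_m[OF that] ind[OF that] by simp
  have integral_f: "integral\<^sup>L (m k) f = (LINT x|m k. x ^ (2 * n)) - r ^ (2 * n) * measure (m k) S"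
    if "k < 4" for k
    unfolding f_def using int_m[OF that] ind[OF that] by simp
  have "ennreal (integral\<^sup>L (m 2) f) \<le> ennreal (integral\<^sup>L (m 0) f)"
    using nn_integral_mono_measure[OF _ \<open>m 2 \<le> m 0\<close>, of f]
    by (simp add: sets nn_integral_eq_integral int_f f_nonneg)
  then have "integral\<^sup>L (m 2) f \<le> integral\<^sup>L (m 0) f"
    by (simp add: f_nonneg)
  moreover have "Re (cm_integral \<nu> (\<lambda>x. of_real (x ^ (2 * n))))
      = (LINT x|m 0. x ^ (2 * n)) - (LINT x|m 2. x ^ (2 * n))"
    unfolding cm_integral_eq[OF J] I integral_complex_of_real by (simp add: sum_lessThan_4 i_power_3)
  ultimately show ?thesis
    by (simp add: integral_f \<nu>[OF S(1)] algebra_simps)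
qed

text \<open>Continuity from below is inherited from the four finite measures.\<close>

lemma cm_decomposition_tendsto:
  assumes "cm_decomposition \<nu> m" "incseq A" "\<And>n. A n \<in> sets borel"
  shows "(\<lambda>n. \<nu> (A n)) \<longlonglongrightarrow> \<nu> (\<Union>n. A n)"
proof -
  have "(\<lambda>n. \<Sum>k<4. \<i> ^ k * of_real (measure (m k) (A n)))
      \<longlonglongrightarrow> (\<Sum>k<4. \<i> ^ k * of_real (measure (m k) (\<Union>n. A n)))"
    using assms by (intro tendsto_intros finite_measure.finite_Lim_measure_incseq)
      (auto simp: cm_decomposition_def)
  moreover have "(\<Union>n. A n) \<in> sets borel" using assms(3) by blast
  ultimately show ?thesis
    using assms by (simp add: cm_decomposition_def)
qed

lemma cm_decomposition_Un:
  assumes "cm_decomposition \<nu> m" "S \<in> sets borel" "T \<in> sets borel" "S \<inter> T = {}"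
  shows "\<nu> (S \<union> T) = \<nu> S + \<nu> T"
proof -
  have "measure (m k) (S \<union> T) = measure (m k) S + measure (m k) T" if "k < 4" for k
    using assms that by (intro finite_measure.finite_measure_Union) (auto simp: cm_decomposition_def)
  moreover have "S \<union> T \<in> sets borel" using assms by blast
  ultimately show ?thesis
    using assms by (simp add: cm_decomposition_def algebra_simps sum.distrib)
qed

text \<open>Mass at a distance from [-1, 1] would make the even moments grow geometrically. The set
  \<open>S\<close> is exhausted by the pieces \<open>A k\<close>, on which |x| is at least 1 +
  1/(k+1), and each piece is null.\<close>

lemma bounded_moments_support:
  assumes int: "\<And>n. cm_integrable \<nu> (\<lambda>x. of_real (x ^ n))"
    and nonneg: "\<And>S. S \<in> sets borel \<Longrightarrow> \<nu> S \<in> \<real>\<^sub>\<ge>\<^sub>0"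
    and bound: "\<And>n. norm (cm_integral \<nu> (\<lambda>x. of_real (x ^ n))) \<le> C"
    and S: "S \<in> sets borel" "S \<inter> {-1..1} = {}"
  shows "\<nu> S = 0"
proof -
  obtain m where m: "cm_decomposition \<nu> m"
    using int[of 0] unfolding cm_integrable_def has_cm_integral_def by blast
  define A where "A k = S \<inter> {x. 1 + 1 / real (Suc k) \<le> \<bar>x\<bar>}" for k
  have "closed {x. 1 + 1 / real (Suc k) \<le> \<bar>x\<bar>}" for k
    by (intro closed_Collect_le continuous_intros)
  then have A: "A k \<in> sets borel" for k
    unfolding A_def using S(1) borel_closed by blast
  have "\<nu> (A k) = 0" for k
  proof -
    let ?r = "1 + 1 / real (Suc k)"
    have bnd: "(?r\<^sup>2) ^ n * Re (\<nu> (A k)) \<le> C" for n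
    proof -
      have "?r ^ (2 * n) * Re (\<nu> (A k)) \<le> Re (cm_integral \<nu> (\<lambda>x. of_real (x ^ (2 * n))))"
        using A int nonneg by (intro tail_le_moment) (auto simp: A_def)
      also have "\<dots> \<le> C"
        using bound[of "2 * n"] complex_Re_le_cmod order_trans by blast
      finally show ?thesis by (simp add: power_mult)
    qed
    have "Re (\<nu> (A k)) \<le> 0"
    proof (rule ccontr)
      assume pos: "\<not> ?thesis"
      have "1 < ?r\<^sup>2" by (intro one_less_power) auto
      then obtain n where "C / Re (\<nu> (A k)) < (?r\<^sup>2) ^ n"
        using real_arch_pow by blast
      with bnd[of n] pos show False by (simp add: field_simps)
    qed
    then show ?thesis
      using nonneg[OF A[of k]] by (simp add: complex_nonneg_Reals_iff complex_eq_iff)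
  qed
  moreover have "incseq A"
  proof (rule incseq_SucI)
    fix k
    have "1 / real (Suc (Suc k)) \<le> 1 / real (Suc k)" by (simp add: frac_le)
    then show "A k \<le> A (Suc k)" by (auto simp: A_def)
  qed
  moreover have "(\<Union>k. A k) = S"
  proof
    show "S \<subseteq> (\<Union>k. A k)"
    proof
      fix x assume "x \<in> S"
      with S(2) have "x \<notin> {-1..1}" by blast
      then have "0 < \<bar>x\<bar> - 1" by auto
      then obtain k where "inverse (real (Suc k)) < \<bar>x\<bar> - 1"
        using reals_Archimedean by blast
      with \<open>x \<in> S\<close> have "x \<in> A k" by (simp add: A_def inverse_eq_divide)
      then show "x \<in> (\<Union>k. A k)" by blast
    qed
  qed (auto simp: A_def)
  ultimately have "(\<lambda>n. 0) \<longlonglongrightarrow> \<nu> S"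
    using cm_decomposition_tendsto[OF m, of A] A by simp
  then show ?thesis using LIMSEQ_unique tendsto_const by blast
qed

text \<open>The measures of a given decomposition may charge the complement of the support; restricting
  them to the support gives another decomposition of the same complex measure.\<close>

lemma has_cm_integral_compact_support:
  fixes f :: "real \<Rightarrow> complex"
  assumes m: "cm_decomposition \<nu> m"
    and supp: "\<And>S. S \<in> sets borel \<Longrightarrow> S \<inter> {-1..1} = {} \<Longrightarrow> \<nu> S = 0"
    and f: "continuous_on UNIV f"
  shows "has_cm_integral \<nu> f (\<Sum>k<4. \<i> ^ k * (LINT x|m k. indicator {-1..1} x *\<^sub>R f x))"
proof -
  define m' where "m' k = density (m k) (indicator {-1..1})" for k
  have sets: "sets (m k) = sets borel" and fin: "finite_measure (m k)" if "k < 4" for k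
    using m that by (auto simp: cm_decomposition_def)
  have "cm_decomposition \<nu> m'"
    unfolding cm_decomposition_def
  proof (intro conjI allI impI ballI)
    fix S :: "real set" assume S: "S \<in> sets borel"
    then have "\<nu> S = \<nu> (({-1..1} \<inter> S) \<union> (S - {-1..1}))" by (simp add: Un_Diff_Int Int_commute Un_commute)
    also have "\<dots> = \<nu> ({-1..1} \<inter> S) + \<nu> (S - {-1..1})"
      using S by (intro cm_decomposition_Un[OF m]) auto
    also have "\<nu> (S - {-1..1}) = 0"
      using S by (intro supp) auto
    also have "\<nu> ({-1..1} \<inter> S) + 0 = (\<Sum>k<4. \<i> ^ k * of_real (measure (m k) ({-1..1} \<inter> S)))"
      using m S by (simp add: cm_decomposition_def)
    also have "\<dots> = (\<Sum>k<4. \<i> ^ k * of_real (measure (m' k) S))"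
      using S by (intro sum.cong refl) (simp add: m'_def measure_restricted sets)
    finally show "\<nu> S = (\<Sum>k<4. \<i> ^ k * of_real (measure (m' k) S))" .
  qed (use sets fin in \<open>auto simp: m'_def intro!: finite_measure.finite_measure_restricted\<close>)
  moreover have "integrable (m' k) f \<and> integral\<^sup>L (m' k) f = (LINT x|m k. indicator {-1..1} x *\<^sub>R f x)"
    if "k < 4" for k
  proof -
    have meas: "f \<in> borel_measurable (m k)" "(indicator {-1..1} :: real \<Rightarrow> real) \<in> borel_measurable (m k)"
      using borel_measurable_continuous_onI[OF f] sets[OF that]
      by (simp_all cong: measurable_cong_sets)
    have "bounded (f ` {-1..1})"
      by (intro compact_imp_bounded compact_continuous_image continuous_on_subset[OF f]) auto
    then obtain B where B: "\<And>x. x \<in> {-1..1} \<Longrightarrow> norm (f x) \<le> B"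
      unfolding bounded_iff by blast
    have "integrable (m k) (\<lambda>x. indicator {-1..1} x *\<^sub>R f x)"
    proof (rule finite_measure.integrable_const_bound[OF fin[OF that], where B = B])
      show "AE x in m k. norm (indicator {-1..1} x *\<^sub>R f x) \<le> B"
        using B order_trans[OF norm_ge_zero B[of 0]] by (intro AE_I2) (auto simp: indicator_def)
    qed (intro borel_measurable_scaleR meas)
    moreover have "m' k = density (m k) (\<lambda>x. ennreal (indicator {-1..1} x))"
      by (simp add: m'_def ennreal_indicator)
    ultimately show ?thesis
      using meas by (simp add: integrable_density integral_density)
  qed
  ultimately show ?thesis
    unfolding has_cm_integral_def by (intro exI[of _ m']) auto
qed

text \<open>Averaging two consecutive powers cancels the contribution of the point \<open>-1\<close>.\<close>

lemma average_power_tendsto_indicator: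
  fixes x :: real
  assumes "\<bar>x\<bar> \<le> 1"
  shows "(\<lambda>n. (x ^ n + x ^ Suc n) / 2) \<longlonglongrightarrow> indicator {1} x"
proof -
  consider "x = 1" | "x = -1" | "\<bar>x\<bar> < 1" using assms by linarith
  then show ?thesis
  proof cases
    case 3
    then have "(\<lambda>n. x ^ n) \<longlonglongrightarrow> 0" by (intro LIMSEQ_power_zero) auto
    from tendsto_divide[OF tendsto_add[OF this LIMSEQ_Suc[OF this]] tendsto_const[of 2]] 3
    show ?thesis by (auto simp: indicator_def)
  qed (simp_all add: power_minus_odd)
qed

text \<open>Dominated convergence for each measure of the decomposition, after cutting the integrand
  off outside [-1, 1].\<close>

lemma cm_integral_power_tendsto:
  fixes f :: "real \<Rightarrow> complex"
  assumes m: "cm_decomposition \<nu> m"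
    and supp: "\<And>S. S \<in> sets borel \<Longrightarrow> S \<inter> {-1..1} = {} \<Longrightarrow> \<nu> S = 0"
    and f: "continuous_on UNIV f"
  shows "(\<lambda>n. (cm_integral \<nu> (\<lambda>x. of_real (x ^ n) * f x) + cm_integral \<nu> (\<lambda>x. of_real (x ^ Suc n) * f x)) / 2)
    \<longlonglongrightarrow> f 1 * \<nu> {1}"
proof -
  have sets: "sets (m k) = sets borel" and fin: "finite_measure (m k)" if "k < 4" for k
    using m that by (auto simp: cm_decomposition_def)
  \<comment> \<open>The cutoff leaves the integral against \<open>\<nu>\<close> unchanged and bounds
    all integrands by the maximum of \<open>f\<close> on [-1, 1], a constant integrable for finite
    measures.\<close>
  define g where "g n x = indicator {-1..1} x *\<^sub>R (of_real (x ^ n) * f x)" for n x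
  have I: "cm_integral \<nu> (\<lambda>x. of_real (x ^ n) * f x) = (\<Sum>k<4. \<i> ^ k * integral\<^sup>L (m k) (g n))" for n
    unfolding g_def
    by (intro cm_integral_eq has_cm_integral_compact_support[OF m supp] continuous_intros f)
  have "bounded (f ` {-1..1})"
    by (intro compact_imp_bounded compact_continuous_image continuous_on_subset[OF f]) auto
  then obtain B where B: "\<And>x. x \<in> {-1..1} \<Longrightarrow> norm (f x) \<le> B"
    unfolding bounded_iff by blast
  then have "0 \<le> B" using order_trans[OF norm_ge_zero B[of 0]] by simp
  have g_bound: "norm (g n x) \<le> B" for n x
  proof (cases "x \<in> {-1..1}")
    case True
    then have "\<bar>x\<bar> ^ n * norm (f x) \<le> 1 * B"
      using B by (intro mult_mono power_le_one) auto
    then show ?thesis using True by (simp add: g_def norm_mult norm_power)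
  qed (use \<open>0 \<le> B\<close> in \<open>simp add: g_def\<close>)
  have "(\<lambda>n. (integral\<^sup>L (m k) (g n) + integral\<^sup>L (m k) (g (Suc n))) / 2)
      \<longlonglongrightarrow> f 1 * of_real (measure (m k) {1})" if "k < 4" for k
  proof -
    interpret finite_measure "m k" using fin[OF that] .
    have fm: "f \<in> borel_measurable borel" by (rule borel_measurable_continuous_onI[OF f])
    have meas: "g n \<in> borel_measurable (m k)" for n
    proof -
      have "g n \<in> borel_measurable borel" unfolding g_def using fm by measurable
      then show ?thesis using sets[OF that] by (simp cong: measurable_cong_sets)
    qed
    have int: "integrable (m k) (g n)" for n
      using g_bound meas by (intro integrable_const_bound[where B = B]) auto
    \<comment> \<open>The limit lives on the point 1 alone, so \<open>f x\<close> can be frozen at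
      \<open>f 1\<close>.\<close>
    have lim: "(\<lambda>n. LINT x|m k. (g n x + g (Suc n) x) / 2) \<longlonglongrightarrow> (LINT x|m k. indicator {1} x *\<^sub>R f 1)"
    proof (rule integral_dominated_convergence[where w = "\<lambda>_. B"])
      have "{1} \<in> sets (m k)" using sets[OF that] by simp
      then show "(\<lambda>x. indicator {1} x *\<^sub>R f 1) \<in> borel_measurable (m k)" by simp
      show "(\<lambda>x. (g n x + g (Suc n) x) / 2) \<in> borel_measurable (m k)" for n
        using meas[of n] meas[of "Suc n"] by simp
      show "AE x in m k. norm ((g n x + g (Suc n) x) / 2) \<le> B" for n
      proof (rule AE_I2)
        fix x
        show "norm ((g n x + g (Suc n) x) / 2) \<le> B"
          using norm_triangle_ineq[of "g n x" "g (Suc n) x"] g_bound[of n x] g_bound[of "Suc n" x]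
          by (simp add: norm_divide)
      qed
      show "AE x in m k. (\<lambda>n. (g n x + g (Suc n) x) / 2) \<longlonglongrightarrow> indicator {1} x *\<^sub>R f 1"
      proof (rule AE_I2)
        fix x
        show "(\<lambda>n. (g n x + g (Suc n) x) / 2) \<longlonglongrightarrow> indicator {1} x *\<^sub>R f 1"
        proof (cases "x \<in> {-1..1}")
          case True
          have "(\<lambda>n. of_real ((x ^ n + x ^ Suc n) / 2) * f x) \<longlonglongrightarrow> of_real (indicator {1} x) * f x"
            using True by (intro tendsto_intros average_power_tendsto_indicator) auto
          moreover have "of_real ((x ^ n + x ^ Suc n) / 2) * f x = (g n x + g (Suc n) x) / 2" for n
            using True by (simp add: g_def algebra_simps add_divide_distrib)
          moreover have "of_real (indicator {1} x) * f x = indicator {1} x *\<^sub>R f 1"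
            by (simp add: indicator_def)
          ultimately show ?thesis by simp
        next
          case False
          then show ?thesis by (auto simp: g_def indicator_def)
        qed
      qed
    qed simp
    have "(LINT x|m k. (g n x + g (Suc n) x) / 2) = (integral\<^sup>L (m k) (g n) + integral\<^sup>L (m k) (g (Suc n))) / 2" for n
      using int[of n] int[of "Suc n"] by simp
    moreover have "(LINT x|m k. indicator {1} x *\<^sub>R f 1) = f 1 * of_real (measure (m k) {1})"
      using sets[OF that] by (simp add: scaleR_conv_of_real)
    ultimately show ?thesis using lim by simp
  qed
  then have "(\<lambda>n. \<Sum>k<4. \<i> ^ k * ((integral\<^sup>L (m k) (g n) + integral\<^sup>L (m k) (g (Suc n))) / 2))
      \<longlonglongrightarrow> (\<Sum>k<4. \<i> ^ k * (f 1 * of_real (measure (m k) {1})))"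
    by (intro tendsto_sum tendsto_mult tendsto_const) simp
  moreover have "\<nu> {1} = (\<Sum>k<4. \<i> ^ k * of_real (measure (m k) {1}))"
    using m by (simp add: cm_decomposition_def)
  ultimately show ?thesis
    unfolding I by (simp add: sum_distrib_left ac_simps add_divide_distrib distrib_left
      sum_divide_distrib sum.distrib)
qed

section \<open>Invariant distributions and the weight matrix\<close>

lemma matrix_inv_mult:
  fixes A :: "'m::finite cmat"
  assumes "invertible A"
  shows "A ** (matrix_inv A ** M) = M"
proof -
  have "A ** matrix_inv A = mat 1"
    using assms unfolding invertible_def matrix_inv_def by (rule someI2_ex) simp
  then show ?thesis by (simp add: matrix_mul_assoc)
qed

lemma matrix_mult_scaleR: "M ** (r *\<^sub>R X) = r *\<^sub>R (M ** X :: 'm::finite cmat)"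
  by (simp add: matrix_matrix_mult_def vec_eq_iff scaleR_sum_right)

lemma scaleR_matrix_vector_mult: "(r *\<^sub>R M) *v v = r *\<^sub>R ((M :: 'm::finite cmat) *v v)"
  by (simp add: matrix_vector_mult_def vec_eq_iff scaleR_sum_right)

lemma matrix_zero_mult: "0 ** M = (0 :: 'm::finite cmat)" "M ** 0 = (0 :: 'm::finite cmat)"
  by (simp_all add: matrix_matrix_mult_def vec_eq_iff)

lemma continuous_on_matrix_mult:
  fixes f g :: "'a::topological_space \<Rightarrow> 'm::finite cmat"
  shows "continuous_on S f \<Longrightarrow> continuous_on S g \<Longrightarrow> continuous_on S (\<lambda>x. f x ** g x)"
  unfolding continuous_on_def by (blast intro: tendsto_matrix_matrix_mult)

lemma continuous_on_qpoly: "continuous_on UNIV (qpoly \<Phi> n)"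
proof -
  have "continuous_on UNIV (\<lambda>x. qpoly \<Phi> n x)"
  proof (induction n rule: induct_nat_012)
    case (ge2 n)
    then show ?case
      unfolding qpoly.simps by (intro continuous_on_matrix_mult continuous_intros)
  next
    case 1
    show ?case
      by simp (intro continuous_on_matrix_mult continuous_intros)
  qed simp
  then show ?thesis by simp
qed

text \<open>Diagonal entries of \<open>W\<close> are positive measures, so bounded moments confine
  them to [-1, 1]; positive semidefiniteness then forces the off-diagonal entries to vanish wherever
  the diagonal does.\<close>

lemma weight_matrix_support:
  assumes W: "weight_matrix W"
    and bound: "\<And>c n. norm (cm_integral (\<lambda>S. W S $ c $ c) (\<lambda>x. of_real (x ^ n))) \<le> C"
    and S: "S \<in> sets borel" "S \<inter> {-1..1} = {}"
  shows "W S $ c $ d = 0"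
proof -
  have psd: "psd (W S)" if "S \<in> sets borel" for S
    using W that by (simp add: weight_matrix_def)
  have "W S $ c $ c = 0" for c
    using W bound S by (intro bounded_moments_support[where \<nu> = "\<lambda>S. W S $ c $ c"])
      (auto simp: weight_matrix_def psd_diag)
  then show ?thesis
    using psd_entry_le[OF psd[OF S(1)], of c d] by simp
qed

lemma weight_integral_power_tendsto:
  assumes W: "weight_matrix W"
    and supp: "\<And>c d S. S \<in> sets borel \<Longrightarrow> S \<inter> {-1..1} = {} \<Longrightarrow> W S $ c $ d = 0"
    and F: "continuous_on UNIV F" and G: "continuous_on UNIV G"
  shows "(\<lambda>n. (1 / 2) *\<^sub>R (weight_integral W F (\<lambda>x. x ^ n *\<^sub>R G x) + weight_integral W F (\<lambda>x. x ^ Suc n *\<^sub>R G x)))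
    \<longlonglongrightarrow> mstar (F 1) ** W {1} ** G 1"
proof (intro vec_tendstoI)
  fix a b
  let ?f = "\<lambda>c d x. mstar (F x) $ a $ c * G x $ d $ b"
  let ?I = "\<lambda>c d n. cm_integral (\<lambda>S. W S $ c $ d) (\<lambda>x. of_real (x ^ n) * ?f c d x)"
  have wi: "weight_integral W F (\<lambda>x. x ^ n *\<^sub>R G x) $ a $ b = (\<Sum>c\<in>UNIV. \<Sum>d\<in>UNIV. ?I c d n)" for n
    by (simp add: weight_integral_def scaleR_conv_of_real[where 'a = complex] ac_simps)
  have "(\<lambda>n. (?I c d n + ?I c d (Suc n)) / 2) \<longlonglongrightarrow> ?f c d 1 * W {1} $ c $ d" for c d
  proof -
    have "cm_integrable (\<lambda>S. W S $ c $ d) (\<lambda>x. of_real (x ^ 0))"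
      using W unfolding weight_matrix_def by blast
    then obtain m where m: "cm_decomposition (\<lambda>S. W S $ c $ d) m"
      unfolding cm_integrable_def has_cm_integral_def by blast
    have "continuous_on UNIV (?f c d)"
      unfolding mstar_def using F G by (simp add: continuous_intros)
    from cm_integral_power_tendsto[OF m supp this] show ?thesis by simp
  qed
  then have "(\<lambda>n. \<Sum>c\<in>UNIV. \<Sum>d\<in>UNIV. (?I c d n + ?I c d (Suc n)) / 2)
      \<longlonglongrightarrow> (\<Sum>c\<in>UNIV. \<Sum>d\<in>UNIV. ?f c d 1 * W {1} $ c $ d)"
    by (intro tendsto_sum)
  moreover have "(\<Sum>c\<in>UNIV. \<Sum>d\<in>UNIV. ?f c d 1 * W {1} $ c $ d) = (mstar (F 1) ** W {1} ** G 1) $ a $ b"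
    by (simp add: matrix_matrix_mult_def sum_distrib_left sum_distrib_right ac_simps) (rule sum.swap)
  moreover have "((1 / 2) *\<^sub>R (weight_integral W F (\<lambda>x. x ^ n *\<^sub>R G x) + weight_integral W F (\<lambda>x. x ^ Suc n *\<^sub>R G x))) $ a $ b
      = (\<Sum>c\<in>UNIV. \<Sum>d\<in>UNIV. (?I c d n + ?I c d (Suc n)) / 2)" for n
    unfolding vector_scaleR_component vector_add_component wi
    by (simp add: scaleR_conv_of_real sum.distrib add_divide_distrib sum_divide_distrib)
  ultimately show "(\<lambda>n. ((1 / 2) *\<^sub>R (weight_integral W F (\<lambda>x. x ^ n *\<^sub>R G x) + weight_integral W F (\<lambda>x. x ^ Suc n *\<^sub>R G x))) $ a $ b)
      \<longlonglongrightarrow> (mstar (F 1) ** W {1} ** G 1) $ a $ b"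
    by simp
qed

section \<open>Averages of consecutive iterates and their limits\<close>

context tridiagonal_qmc
begin

definition average :: "nat \<Rightarrow> 'n cmat \<Rightarrow> nat \<Rightarrow> nat \<Rightarrow> 'n cmat" where
  "average j X n = (\<lambda>i. (1 / 2) *\<^sub>R ((step ^^ n) (point j X) i + (step ^^ Suc n) (point j X) i))"

lemma psd_average: "psd X \<Longrightarrow> psd (average j X n i)"
  unfolding average_def by (intro psd_scaleR psd_add psd_iterate psd_point) auto

lemma step_average: "step (average j X n) i = average j X (Suc n) i"
  by (simp add: average_def step_scaleR step_add)

lemma trace_average_le:
  assumes "psd X"
  shows "(\<Sum>i\<le>m. Re (trace (average j X n i))) \<le> Re (trace X)"
proof -
  have "(\<Sum>i\<le>m. Re (trace (average j X n i)))
      = ((\<Sum>i\<le>m. Re (trace ((step ^^ n) (point j X) i))) + (\<Sum>i\<le>m. Re (trace ((step ^^ Suc n) (point j X) i)))) / 2"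
    unfolding average_def trace_scaleR trace_add by (simp add: sum.distrib sum_divide_distrib add_divide_distrib)
  also have "\<dots> \<le> (Re (trace X) + Re (trace X)) / 2"
    by (intro divide_right_mono add_mono trace_iterate_point_le assms) simp
  finally show ?thesis by simp
qed

text \<open>Mass may escape to infinity, so the limit need not keep the trace of \<open>X\<close>;
  it is enough that its total trace is finite and nonzero, which allows normalisation.\<close>

lemma invariant_distribution_from_limit:
  assumes X: "psd X" and lim: "\<And>i. (\<lambda>n. average j X n i) \<longlonglongrightarrow> \<sigma> i" and "\<sigma> i\<^sub>0 \<noteq> 0"
  shows "\<exists>\<rho>. invariant_distribution \<Phi> \<rho>"
proof -
  have psd_\<sigma>: "psd (\<sigma> i)" for i
    using psd_limit[OF lim] psd_average[OF X] by blast
  have step_\<sigma>: "step \<sigma> i = \<sigma> i" for i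
  proof -
    \<comment> \<open>A step shifts the sequence of averages by one index, and \<open>step\<close>
      is continuous vertex by vertex because each row is finite; hence the limit is a fixed
      point.\<close>
    have "(\<lambda>n. average j X (Suc n) i) \<longlonglongrightarrow> step \<sigma> i"
      using tendsto_step[where \<rho> = "average j X", OF lim] by (simp add: step_average)
    then show ?thesis using LIMSEQ_unique LIMSEQ_Suc[OF lim] by blast
  qed
  define t where "t i = Re (trace (\<sigma> i))" for i
  have trace_\<sigma>: "trace (\<sigma> i) = of_real (t i)" and t_nonneg: "0 \<le> t i" for i
    using psd_trace[OF psd_\<sigma>, of i] by (auto simp: t_def complex_nonneg_Reals_iff complex_eq_iff)
  \<comment> \<open>Fatou's lemma in elementary form: the bound passes to the limit on each finite
    set of vertices.\<close>
  have le: "(\<Sum>i\<le>m. t i) \<le> Re (trace X)" for m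
  proof (rule LIMSEQ_le_const2)
    show "(\<lambda>n. \<Sum>i\<le>m. Re (trace (average j X n i))) \<longlonglongrightarrow> (\<Sum>i\<le>m. t i)"
      unfolding t_def by (intro tendsto_sum tendsto_Re tendsto_trace lim)
  qed (use trace_average_le[OF X] in blast)
  have summable: "summable t"
  proof (rule summableI_nonneg_bounded[OF t_nonneg])
    show "(\<Sum>i<m. t i) \<le> Re (trace X)" for m
      by (rule order_trans[OF sum_mono2 le[of m]]) (auto simp: t_nonneg)
  qed
  have "t i\<^sub>0 \<noteq> 0"
    using psd_trace_eq_0[OF psd_\<sigma>, of i\<^sub>0] \<open>\<sigma> i\<^sub>0 \<noteq> 0\<close> by (auto simp: trace_\<sigma>)
  then have pos: "0 < suminf t"
    using t_nonneg[of i\<^sub>0] by (intro suminf_pos2[OF summable t_nonneg, of i\<^sub>0]) auto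
  have "invariant_distribution \<Phi> (\<lambda>i. (1 / suminf t) *\<^sub>R \<sigma> i)"
    unfolding invariant_distribution_def
  proof (intro conjI allI ext)
    show "psd ((1 / suminf t) *\<^sub>R \<sigma> i)" for i
      using pos by (intro psd_scaleR psd_\<sigma>) auto
    have "(\<lambda>i. t i / suminf t) sums (suminf t / suminf t)"
      by (intro sums_divide summable_sums summable)
    then have "(\<lambda>i. complex_of_real (t i / suminf t)) sums of_real 1"
      using pos by (intro sums_of_real) simp
    then show "(\<lambda>i. trace ((1 / suminf t) *\<^sub>R \<sigma> i)) sums 1"
      by (simp add: trace_scaleR trace_\<sigma> scaleR_conv_of_real[where 'a = complex])
    show "step (\<lambda>i. (1 / suminf t) *\<^sub>R \<sigma> i) i = (1 / suminf t) *\<^sub>R \<sigma> i" for i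
      by (simp add: step_scaleR step_\<sigma>)
  qed
  then show ?thesis by blast
qed

lemma iterate_superposition:
  "(\<lambda>j. trace ((step ^^ n) (point j (\<rho> j)) i)) sums trace ((step ^^ n) \<rho> i)"
proof -
  have "(step ^^ n) (point j (\<rho> j)) i = 0" if "j \<notin> {..i + n}" for j
  proof -
    \<comment> \<open>The column agrees with zero on the vertices that can reach i; zero is written
      as an empty sum so that \<open>iterate_sum\<close> evaluates its iterates.\<close>
    have "(step ^^ n) (point j (\<rho> j)) i = (step ^^ n) (\<lambda>k. \<Sum>x\<in>{}. point x (\<rho> x) k) i"
      using that by (intro iterate_cong) (auto simp: point_def)
    then show ?thesis unfolding iterate_sum by simp
  qed
  then have "(\<lambda>j. trace ((step ^^ n) (point j (\<rho> j)) i)) sums (\<Sum>j\<le>i + n. trace ((step ^^ n) (point j (\<rho> j)) i))"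
    by (intro sums_finite) auto
  moreover have "(\<Sum>j\<le>i + n. (step ^^ n) (point j (\<rho> j)) i) = (step ^^ n) \<rho> i"
    unfolding iterate_sum[symmetric] by (intro iterate_cong) (simp add: point_def)
  ultimately show ?thesis
    by (simp flip: trace_sum)
qed

text \<open>An invariant column is the superposition of its point columns. If the average from each
  of them dies out at i, dominated convergence over the starting vertex j gives trace zero at every
  i, against total trace one.\<close>

lemma no_invariant_distribution:
  assumes "\<And>j X i. (\<lambda>n. average j X n i) \<longlonglongrightarrow> 0"
  shows "\<not> invariant_distribution \<Phi> \<rho>"
proof
  assume inv: "invariant_distribution \<Phi> \<rho>"
  then have psd_\<rho>: "psd (\<rho> j)" and sum1: "(\<lambda>j. trace (\<rho> j)) sums 1" and "step \<rho> = \<rho>" for j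
    by (auto simp: invariant_distribution_def)
  then have iterate: "(step ^^ n) \<rho> = \<rho>" for n
    by (induction n) auto
  have "trace (\<rho> i) = 0" for i
  proof -
    let ?a = "\<lambda>j n. trace (average j (\<rho> j) n i)"
    have sums: "(\<lambda>j. ?a j n) sums trace (\<rho> i)" for n
    proof -
      have "(\<lambda>j. (1 / 2) *\<^sub>R (trace ((step ^^ n) (point j (\<rho> j)) i) + trace ((step ^^ Suc n) (point j (\<rho> j)) i)))
          sums ((1 / 2) *\<^sub>R (trace (\<rho> i) + trace (\<rho> i)))"
        using iterate_superposition[of n \<rho> i] iterate_superposition[of "Suc n" \<rho> i]
        unfolding iterate by (intro sums_scaleR_right sums_add)
      then show ?thesis
        unfolding average_def trace_scaleR trace_add by (simp add: scaleR_conv_of_real)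
    qed
    \<comment> \<open>The trace found at i is at most the trace started at j. This majorant is
      independent of n and summable over j, as Tannery's theorem requires.\<close>
    have bound: "norm (?a j n) \<le> Re (trace (\<rho> j))" for j n
    proof -
      have nonneg: "trace (average j (\<rho> j) n k) \<in> \<real>\<^sub>\<ge>\<^sub>0" for k
        by (intro psd_trace psd_average psd_\<rho>)
      then have "norm (?a j n) = Re (?a j n)"
        by (rule nonneg_Reals_cmod_eq_Re)
      also have "\<dots> \<le> (\<Sum>k\<le>i. Re (trace (average j (\<rho> j) n k)))"
        using nonneg by (intro member_le_sum) (auto simp: complex_nonneg_Reals_iff)
      also have "\<dots> \<le> Re (trace (\<rho> j))"
        by (rule trace_average_le[OF psd_\<rho>])
      finally show ?thesis .
    qed
    have limit: "(\<lambda>n. ?a j n) \<longlonglongrightarrow> 0" for j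
      using tendsto_trace[OF assms[of j "\<rho> j" i]] by simp
    have "summable (\<lambda>j. Re (trace (\<rho> j)))"
      using sums_Re[OF sum1] by (rule sums_summable)
    moreover have "\<forall>\<^sub>F (j, n) in at_top \<times>\<^sub>F sequentially. norm (?a j n) \<le> Re (trace (\<rho> j))"
      by (rule always_eventually) (use bound in auto)
    ultimately have "(\<lambda>n. \<Sum>j. ?a j n) \<longlonglongrightarrow> (\<Sum>j. 0)"
      using tannerys_theorem[of ?a "\<lambda>_. 0" sequentially, OF limit] by simp
    moreover have "(\<Sum>j. ?a j n) = trace (\<rho> i)" for n
      using sums_unique[OF sums] by simp
    ultimately show ?thesis
      by (simp add: LIMSEQ_const_iff)
  qed
  then show False using sum1 sums_unique2[OF sum1, of 0] by simp
qed

text \<open>From a positive matrix, the mass at vertex i never exceeds the initial trace, and trace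
  bounds entries; positive inputs suffice by polarisation.\<close>

lemma powers_bounded:
  obtains C where "\<And>n p q. norm (bpow (qmc_rep \<Phi>) n i j $ p $ q) \<le> C"
proof (rule matrix_bounded_if_psd_bounded[of "\<lambda>n. bpow (qmc_rep \<Phi>) n i j"])
  fix X :: "'n cmat" assume X: "psd X"
  have "norm (bpow (qmc_rep \<Phi>) n i j *v rvec X) \<le> (\<Sum>p\<in>(UNIV :: ('n \<times> 'n) set). 2 * Re (trace X))" for n
  proof -
    let ?Y = "\<lambda>i. (step ^^ n) (point j X) i"
    have psd: "psd (?Y i)" for i by (intro psd_iterate psd_point X)
    have "Re (trace (?Y i)) \<le> (\<Sum>k\<le>i. Re (trace (?Y k)))"
      using psd_trace[OF psd] by (intro member_le_sum) (auto simp: complex_nonneg_Reals_iff)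
    also have "\<dots> \<le> Re (trace X)" by (rule trace_iterate_point_le[OF X])
    finally have "norm (rvec (?Y i) $ p) \<le> 2 * Re (trace X)" for p
      using psd_norm_entry_le_trace[OF psd[of i], of "fst p" "snd p"] by (simp add: rvec_def)
    then have "(\<Sum>p\<in>UNIV. norm (rvec (?Y i) $ p)) \<le> (\<Sum>p\<in>(UNIV :: ('n \<times> 'n) set). 2 * Re (trace X))"
      by (intro sum_mono)
    moreover have "norm (rvec (?Y i)) \<le> (\<Sum>p\<in>UNIV. norm (rvec (?Y i) $ p))"
      unfolding norm_vec_def by (intro L2_set_le_sum) simp
    ultimately show ?thesis by (simp only: rvec_iterate_point)
  qed
  then show "\<exists>C. \<forall>n. norm (bpow (qmc_rep \<Phi>) n i j *v rvec X) \<le> C" by blast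
qed (use that in blast)

lemma average_tendsto:
  assumes W: "admits_weight_matrix \<Phi> W"
  shows "(\<lambda>n. average j X n i) \<longlonglongrightarrow> unrvec ((matrix_inv (weight_integral W (qpoly \<Phi> i) (qpoly \<Phi> i)) **
    (mstar (qpoly \<Phi> i 1) ** W {1} ** qpoly \<Phi> j 1)) *v rvec X)"
proof -
  let ?P = "\<lambda>i. weight_integral W (qpoly \<Phi> i) (qpoly \<Phi> i)"
  have weight: "weight_matrix W" and inv: "invertible (?P i)"
    and rep: "bpow (qmc_rep \<Phi>) n i j = matrix_inv (?P i) ** weight_integral W (qpoly \<Phi> i) (\<lambda>x. x ^ n *\<^sub>R qpoly \<Phi> j x)"
    for n i j
    using W unfolding admits_weight_matrix_def by blast+
  obtain C where C: "\<And>n p q. norm (bpow (qmc_rep \<Phi>) n 0 0 $ p $ q) \<le> C"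
    using powers_bounded by blast
  \<comment> \<open>\<open>cm_integral\<close> is a definite description, so even the integral of
    zero needs a decomposition to exist; the zeroth moment supplies one.\<close>
  have zero_integral: "cm_integral (\<lambda>S. W S $ c $ d) (\<lambda>_. 0) = 0" for c d
  proof -
    have "cm_integrable (\<lambda>S. W S $ c $ d) (\<lambda>x. of_real (x ^ 0))"
      using weight unfolding weight_matrix_def by blast
    then obtain m where "cm_decomposition (\<lambda>S. W S $ c $ d) m"
      unfolding cm_integrable_def has_cm_integral_def by blast
    then show ?thesis
      by (intro cm_integral_eq) (auto simp: has_cm_integral_def)
  qed
  have "norm (cm_integral (\<lambda>S. W S $ c $ c) (\<lambda>x. of_real (x ^ n)))
      \<le> (\<Sum>c\<in>UNIV. \<Sum>k\<in>UNIV. norm (?P 0 $ c $ k) * C)" (is "?l \<le> ?r") for c n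
  proof -
    have "cm_integral (\<lambda>S. W S $ c' $ d) (\<lambda>x. mstar (mat 1) $ c $ c' * (x ^ n *\<^sub>R mat 1) $ d $ c)
        = (if d = c then if c' = c then cm_integral (\<lambda>S. W S $ c $ c) (\<lambda>x. of_real (x ^ n)) else 0 else 0)" for c' d
      by (auto simp: mstar_def mat_def zero_integral scaleR_conv_of_real[where 'a = complex])
    \<comment> \<open>Since Q_0 is the identity, the moments of \<open>W\<close> are the weight
      integrals for block (0, 0), that is, a fixed matrix times the bounded powers.\<close>
    then have "cm_integral (\<lambda>S. W S $ c $ c) (\<lambda>x. of_real (x ^ n))
        = weight_integral W (qpoly \<Phi> 0) (\<lambda>x. x ^ n *\<^sub>R qpoly \<Phi> 0 x) $ c $ c"
      by (simp add: weight_integral_def)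
    also have "\<dots> = (?P 0 ** bpow (qmc_rep \<Phi>) n 0 0) $ c $ c"
      by (simp only: rep matrix_inv_mult[OF inv])
    also have "norm \<dots> \<le> (\<Sum>k\<in>UNIV. norm (?P 0 $ c $ k) * C)"
      unfolding matrix_matrix_mult_def vec_lambda_beta
      by (rule sum_norm_le) (simp add: norm_mult mult_left_mono C)
    also have "\<dots> \<le> ?r"
      using order_trans[OF norm_ge_zero C]
      by (intro member_le_sum[where f = "\<lambda>c. \<Sum>k\<in>UNIV. norm (?P 0 $ c $ k) * C"])
        (auto intro!: sum_nonneg mult_nonneg_nonneg)
    finally show ?thesis .
  qed
  note supp = weight_matrix_support[OF weight this]
  let ?L = "\<lambda>n. (1 / 2) *\<^sub>R (weight_integral W (qpoly \<Phi> i) (\<lambda>x. x ^ n *\<^sub>R qpoly \<Phi> j x)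
    + weight_integral W (qpoly \<Phi> i) (\<lambda>x. x ^ Suc n *\<^sub>R qpoly \<Phi> j x))"
  have lim: "?L \<longlonglongrightarrow> mstar (qpoly \<Phi> i 1) ** W {1} ** qpoly \<Phi> j 1"
    by (intro weight_integral_power_tendsto weight supp continuous_on_qpoly)
  have unrvec_avg: "(1 / 2) *\<^sub>R (unrvec u + unrvec v) = unrvec ((1 / 2) *\<^sub>R (u + v))" for u v :: "complex^('n \<times> 'n)"
    by (simp add: unrvec_def vec_eq_iff)
  have it: "(step ^^ n) (point j X) i = unrvec (bpow (qmc_rep \<Phi>) n i j *v rvec X)" for n
    by (metis rvec_iterate_point rvec_unrvec(2))
  have "average j X n i = unrvec ((matrix_inv (?P i) ** ?L n) *v rvec X)" for n
    unfolding average_def it unrvec_avg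
    by (simp only: rep matrix_mult_scaleR scaleR_matrix_vector_mult matrix_add_ldistrib matrix_vector_mult_add_rdistrib)
  then show ?thesis
    by (simp only:) (intro tendsto_unrvec tendsto_matrix_vector_mult tendsto_matrix_matrix_mult tendsto_const lim)
qed

end

section \<open>Positive recurrence and the jump at 1\<close>

theorem proposition4p2:
  fixes \<Phi> :: "'n::finite qmc" and W :: "real set \<Rightarrow> ('n \<times> 'n) cmat"
  assumes "is_qmc \<Phi>"
    and "qmc_irreducible \<Phi>"
    and "block_tridiagonal \<Phi>"
    and "\<forall>n. invertible (blkA \<Phi> n)"
    and "admits_weight_matrix \<Phi> W"
  shows "positive_recurrent \<Phi> \<longleftrightarrow> W {1} \<noteq> 0"
proof -
  interpret tridiagonal_qmc \<Phi> using assms(1,3) by unfold_locales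
  note lim = average_tendsto[OF assms(5)]
  have "\<exists>\<rho>. invariant_distribution \<Phi> \<rho>" if "W {1} \<noteq> 0"
  proof -
    let ?P = "weight_integral W (qpoly \<Phi> 0) (qpoly \<Phi> 0)"
    let ?E = "matrix_inv ?P ** (mstar (qpoly \<Phi> 0 1) ** W {1} ** qpoly \<Phi> 0 1)"
    have "invertible ?P" using assms(5) unfolding admits_weight_matrix_def by blast
    moreover have "mstar (mat 1) = (mat 1 :: ('n \<times> 'n) cmat)"
      by (simp add: mstar_def mat_def vec_eq_iff)
    \<comment> \<open>As Q_0(1) is the identity, \<open>?E\<close> is W({1}) up to an invertible
      factor, so it inherits nonvanishing.\<close>
    ultimately have "?P ** ?E = W {1}"
      by (simp add: matrix_inv_mult)
    with that have "?E \<noteq> 0" by (metis matrix_zero_mult(2))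
    then obtain X :: "'n cmat" where X: "psd X" "?E *v rvec X \<noteq> 0"
      by (rule psd_detects_nonzero)
    have "rvec (unrvec (?E *v rvec X)) \<noteq> rvec 0"
      using X(2) by (simp add: rvec_def vec_eq_iff unrvec_def)
    then have "unrvec (?E *v rvec X) \<noteq> 0" by metis
    with X(1) show ?thesis
      by (intro invariant_distribution_from_limit[OF _ lim[where j = 0 and X = X], where i\<^sub>0 = 0]) simp_all
  qed
  moreover have "\<not> invariant_distribution \<Phi> \<rho>" if "W {1} = 0" for \<rho>
  proof (rule no_invariant_distribution)
    show "(\<lambda>n. average j X n i) \<longlonglongrightarrow> 0" for j X i
    proof -
      have "unrvec 0 = (0 :: 'n cmat)" by (simp add: unrvec_def vec_eq_iff)
      then show ?thesis using lim[of j X i] that by (simp add: matrix_zero_mult)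
    qed
  qed
  ultimately show ?thesis
    using assms(2) unfolding positive_recurrent_def by blast
qed

end
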